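(* There exists a visual roughly geodesic Gromov hyperbolic metric space $X$ that is quasi-isometrically co-Hopfian and whose boundary at infinity $\partial_\infty X$ is a Sierpiński carpet.
   Context: A map $\phi$ from a metric space $(X,d_X)$ to a metric space $(Y,d_Y)$ is a $(\lambda,C)$-quasi-isometric embedding ($\lambda\ge 1$, $C\ge 0$) if $\frac1\lambda d_X(p,q)-C\le d_Y(\phi(p),\phi(q))\le \lambda d_X(p,q)+C$ for all $p,q\in X$; it is a quasi-isometric embedding if this holds for some $\lambda, C$. It is a quasi-isometry if in addition there is $D\ge 0$ such that every point of $Y$ is within distance $D$ of $\phi(X)$. A metric space $X$ is quasi-isometrically co-Hopfian if every quasi-isometric embedding of $X$ into itself is a quasi-isometry. A $C$-roughly geodesic segment $[p,q]$ in $X$ is a $(1,C)$-quasi-isometric embedding $i$ of a segment $[a,b]\subset\mathbb{R}$ into $X$ with $i(a)=p$, $i(b)=q$; a $C$-roughly geodesic ray is a $(1,C)$-quasi-isometric embedding of $[a,\infty)$ into $X$ for some $a\in\mathbb{R}$. The space $X$ is roughly geodesic if there is $C\ge 0$ such that any two points are joined by a $C$-roughly geodesic segment. A roughly geodesic space is Gromov hyperbolic if there is $\delta\ge 0$ such that every triangle $[p,q]\cup[q,q']\cup[q',p]$ formed by roughly geodesic segments is $\delta$-thin, i.e., each side lies in the $\delta$-neighborhood of the union of the other two (for roughly geodesic spaces this agrees with hyperbolicity defined via the Gromov product). It is visual if there are a base point $o\in X$ and $C\ge 0$ such that every $p\in X$ lies on a $C$-roughly geodesic ray $i\colon[a,\infty)\to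 X$ with $i(a)=o$. The boundary at infinity $\partial_\infty X$ is the set of equivalence classes of roughly geodesic rays, two rays being equivalent if their Hausdorff distance is finite; it carries the canonical family of visual metrics (metrics comparable to $e^{-\varepsilon(\xi|\xi')_o}$, where $(\cdot|\cdot)_o$ is the Gromov product extended to the boundary and $\varepsilon>0$ is small), and its topology is the one induced by these metrics. A Sierpiński carpet is a compact topological space homeomorphic to the standard Sierpiński carpet $S_3$, i.e., the planar set obtained from the closed unit square by subdividing it into $9$ equal subsquares, removing the open middle one, and repeating this on the remaining subsquares indefinitely. *)

theory Defs
  imports "HOL-Analysis.Analysis"
begin

section \<open>Quasi-isometries\<close>

text \<open>Metric spaces are given by a carrier and a distance function, as in the locale
  \<^locale>\<open>Metric_space\<close>.\<close>

definition qi_embedding_with ::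
  "real \<Rightarrow> real \<Rightarrow> 'a set \<Rightarrow> ('a \<Rightarrow> 'a \<Rightarrow> real) \<Rightarrow> 'b set \<Rightarrow> ('b \<Rightarrow> 'b \<Rightarrow> real) \<Rightarrow> ('a \<Rightarrow> 'b) \<Rightarrow> bool"
  where "qi_embedding_with l C X dX Y dY f \<longleftrightarrow>
    l \<ge> 1 \<and> C \<ge> 0 \<and> f \<in> X \<rightarrow> Y \<and>
    (\<forall>p\<in>X. \<forall>q\<in>X. 1 / l * dX p q - C \<le> dY (f p) (f q) \<and> dY (f p) (f q) \<le> l * dX p q + C)"

definition qi_embedding ::
  "'a set \<Rightarrow> ('a \<Rightarrow> 'a \<Rightarrow> real) \<Rightarrow> 'b set \<Rightarrow> ('b \<Rightarrow> 'b \<Rightarrow> real) \<Rightarrow> ('a \<Rightarrow> 'b) \<Rightarrow> bool"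
  where "qi_embedding X dX Y dY f \<longleftrightarrow> (\<exists>l C. qi_embedding_with l C X dX Y dY f)"

definition quasi_isometry ::
  "'a set \<Rightarrow> ('a \<Rightarrow> 'a \<Rightarrow> real) \<Rightarrow> 'b set \<Rightarrow> ('b \<Rightarrow> 'b \<Rightarrow> real) \<Rightarrow> ('a \<Rightarrow> 'b) \<Rightarrow> bool"
  where "quasi_isometry X dX Y dY f \<longleftrightarrow>
    qi_embedding X dX Y dY f \<and> (\<exists>D\<ge>0. \<forall>y\<in>Y. \<exists>x\<in>X. dY y (f x) \<le> D)"

definition qi_co_Hopfian :: "'a set \<Rightarrow> ('a \<Rightarrow> 'a \<Rightarrow> real) \<Rightarrow> bool"
  where "qi_co_Hopfian X d \<longleftrightarrow> (\<forall>f. qi_embedding X d X d f \<longrightarrow> quasi_isometry X d X d f)"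

section \<open>Roughly geodesic, Gromov hyperbolic and visual spaces\<close>

definition rough_segment ::
  "'a set \<Rightarrow> ('a \<Rightarrow> 'a \<Rightarrow> real) \<Rightarrow> real \<Rightarrow> 'a \<Rightarrow> 'a \<Rightarrow> real \<Rightarrow> real \<Rightarrow> (real \<Rightarrow> 'a) \<Rightarrow> bool"
  where "rough_segment X d C p q a b i \<longleftrightarrow>
    a \<le> b \<and> qi_embedding_with 1 C {a..b} dist X d i \<and> i a = p \<and> i b = q"

text \<open>A ray is a pair of an initial parameter \<open>a\<close> and a map on the reals; only the values of the
  map on \<open>{a..}\<close> matter.\<close>

definition rough_ray ::
  "'a set \<Rightarrow> ('a \<Rightarrow> 'a \<Rightarrow> real) \<Rightarrow> real \<Rightarrow> real \<times> (real \<Rightarrow> 'a) \<Rightarrow> bool"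
  where "rough_ray X d C = (\<lambda>(a, i). qi_embedding_with 1 C {a..} dist X d i)"

definition roughly_geodesic :: "'a set \<Rightarrow> ('a \<Rightarrow> 'a \<Rightarrow> real) \<Rightarrow> bool"
  where "roughly_geodesic X d \<longleftrightarrow>
    (\<exists>C\<ge>0. \<forall>p\<in>X. \<forall>q\<in>X. \<exists>a b i. rough_segment X d C p q a b i)"

definition in_nbhd :: "('a \<Rightarrow> 'a \<Rightarrow> real) \<Rightarrow> real \<Rightarrow> 'a set \<Rightarrow> 'a set \<Rightarrow> bool"
  where "in_nbhd d r A B \<longleftrightarrow> (\<forall>x\<in>A. \<exists>y\<in>B. d x y \<le> r)"

text \<open>The thinness constant may depend on the roughness constant of the sides: in an unbounded
  space no single constant can serve all roughness constants at once.\<close>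

definition Gromov_hyperbolic :: "'a set \<Rightarrow> ('a \<Rightarrow> 'a \<Rightarrow> real) \<Rightarrow> bool"
  where "Gromov_hyperbolic X d \<longleftrightarrow>
    (\<forall>C\<ge>0. \<exists>\<delta>\<ge>0. \<forall>p q r a1 b1 i1 a2 b2 i2 a3 b3 i3.
       rough_segment X d C p q a1 b1 i1 \<longrightarrow>
       rough_segment X d C q r a2 b2 i2 \<longrightarrow>
       rough_segment X d C r p a3 b3 i3 \<longrightarrow>
         in_nbhd d \<delta> (i1 ` {a1..b1}) (i2 ` {a2..b2} \<union> i3 ` {a3..b3}) \<and>
         in_nbhd d \<delta> (i2 ` {a2..b2}) (i3 ` {a3..b3} \<union> i1 ` {a1..b1}) \<and>
         in_nbhd d \<delta> (i3 ` {a3..b3}) (i1 ` {a1..b1} \<union> i2 ` {a2..b2}))"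

definition visual :: "'a set \<Rightarrow> ('a \<Rightarrow> 'a \<Rightarrow> real) \<Rightarrow> bool"
  where "visual X d \<longleftrightarrow>
    (\<exists>w\<in>X. \<exists>C\<ge>0. \<forall>p\<in>X. \<exists>a i. rough_ray X d C (a, i) \<and> i a = w \<and> p \<in> i ` {a..})"

section \<open>The boundary at infinity\<close>

definition rough_rays :: "'a set \<Rightarrow> ('a \<Rightarrow> 'a \<Rightarrow> real) \<Rightarrow> (real \<times> (real \<Rightarrow> 'a)) set"
  where "rough_rays X d = {\<gamma>. \<exists>C\<ge>0. rough_ray X d C \<gamma>}"

definition ray_equiv ::
  "'a set \<Rightarrow> ('a \<Rightarrow> 'a \<Rightarrow> real) \<Rightarrow> ((real \<times> (real \<Rightarrow> 'a)) \<times> (real \<times> (real \<Rightarrow> 'a))) set"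
  where "ray_equiv X d =
    {((a, i), (b, j)). (a, i) \<in> rough_rays X d \<and> (b, j) \<in> rough_rays X d \<and>
       (\<exists>D\<ge>0. in_nbhd d D (i ` {a..}) (j ` {b..}) \<and> in_nbhd d D (j ` {b..}) (i ` {a..}))}"

definition boundary :: "'a set \<Rightarrow> ('a \<Rightarrow> 'a \<Rightarrow> real) \<Rightarrow> (real \<times> (real \<Rightarrow> 'a)) set set"
  where "boundary X d = rough_rays X d // ray_equiv X d"

definition Gromov_product :: "('a \<Rightarrow> 'a \<Rightarrow> real) \<Rightarrow> 'a \<Rightarrow> 'a \<Rightarrow> 'a \<Rightarrow> real"
  where "Gromov_product d w p q = (d p w + d q w - d p q) / 2"

text \<open>The extension to the boundary uses the supremum over all representatives. In a hyperbolic
  space, taking the infimum instead changes the values by at most an additive constant and so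
  yields the same visual metrics.\<close>

definition boundary_Gromov_product ::
  "('a \<Rightarrow> 'a \<Rightarrow> real) \<Rightarrow> 'a \<Rightarrow> (real \<times> (real \<Rightarrow> 'a)) set \<Rightarrow> (real \<times> (real \<Rightarrow> 'a)) set \<Rightarrow> ereal"
  where "boundary_Gromov_product d w \<xi> \<eta> =
    (SUP (\<gamma>, \<gamma>') \<in> \<xi> \<times> \<eta>.
       Liminf (at_top \<times>\<^sub>F at_top) (\<lambda>(s, t). ereal (Gromov_product d w (snd \<gamma> s) (snd \<gamma>' t))))"

definition exp_minus :: "real \<Rightarrow> ereal \<Rightarrow> real"
  where "exp_minus \<epsilon> x = (if x = \<infinity> then 0 else exp (- \<epsilon> * real_of_ereal x))"

definition visual_metric ::
  "'a set \<Rightarrow> ('a \<Rightarrow> 'a \<Rightarrow> real) \<Rightarrow>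
   ((real \<times> (real \<Rightarrow> 'a)) set \<Rightarrow> (real \<times> (real \<Rightarrow> 'a)) set \<Rightarrow> real) \<Rightarrow> bool"
  where "visual_metric X d \<rho> \<longleftrightarrow>
    Metric_space (boundary X d) \<rho> \<and>
    (\<exists>w\<in>X. \<exists>\<epsilon>>0. \<exists>K\<ge>1. \<forall>\<xi>\<in>boundary X d. \<forall>\<eta>\<in>boundary X d.
       1 / K * exp_minus \<epsilon> (boundary_Gromov_product d w \<xi> \<eta>) \<le> \<rho> \<xi> \<eta> \<and>
       \<rho> \<xi> \<eta> \<le> K * exp_minus \<epsilon> (boundary_Gromov_product d w \<xi> \<eta>))"

section \<open>Sierpinski carpets\<close>

text \<open>Lower left corners of the closed squares of side \<open>1 / 3 ^ n\<close> that remain after \<open>n\<close> steps.\<close>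

fun carpet_corners :: "nat \<Rightarrow> (real \<times> real) set"
  where
    "carpet_corners 0 = {(0, 0)}"
  | "carpet_corners (Suc n) =
      {(x + real k / 3 ^ Suc n, y + real l / 3 ^ Suc n) | x y k l.
         (x, y) \<in> carpet_corners n \<and> k \<le> 2 \<and> l \<le> 2 \<and> (k, l) \<noteq> (1, 1)}"

definition standard_carpet :: "(real \<times> real) set"
  where "standard_carpet =
    (\<Inter>n. \<Union>(x, y)\<in>carpet_corners n. {x..x + 1 / 3 ^ n} \<times> {y..y + 1 / 3 ^ n})"

definition Sierpinski_carpet :: "'a topology \<Rightarrow> bool"
  where "Sierpinski_carpet T \<longleftrightarrow>
    compact_space T \<and> T homeomorphic_space top_of_set standard_carpet"

text \<open>The topology of the boundary is the one induced by the visual metrics; they are required to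
  exist, so that the condition on all of them is not vacuous.\<close>

definition boundary_is_Sierpinski_carpet :: "'a set \<Rightarrow> ('a \<Rightarrow> 'a \<Rightarrow> real) \<Rightarrow> bool"
  where "boundary_is_Sierpinski_carpet X d \<longleftrightarrow>
    (\<exists>\<rho>. visual_metric X d \<rho>) \<and>
    (\<forall>\<rho>. visual_metric X d \<rho> \<longrightarrow>
       Sierpinski_carpet (Metric_space.mtopology (boundary X d) \<rho>))"

end

theory Submission
  imports Defs
begin

text \<open>The hyperbolic cone over a compact metric space \<open>(Z, \<rho>)\<close> is \<open>Z \<times> [0, \<infinity>)\<close> with
  \<open>d((x, s), (y, t)) = s + t + 2 ln (\<rho>(x, y) + exp (- min s t))\<close>. It is visual, roughly geodesic and
  Gromov hyperbolic, its boundary is \<open>Z\<close>, and its visual metrics are comparable to powers of \<open>\<rho>\<close>.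

  For \<open>Z\<close> take the standard carpet; the metric \<open>\<rho>\<close> can be any metric inducing its topology.
  It is chosen so that the cone is rigid. Let \<open>z\<^sub>n\<close> run through a dense set infinitely often, and
  start from the Euclidean metric. At the scale \<open>h\<^sub>n = exp (- (n + 1)!)\<close> near \<open>z\<^sub>n\<close>, add a bounded term
  that makes extremely many points \<open>h\<^sub>n\<close>-separated while they stay at distance at most \<open>3 h\<^sub>n\<close> from \<open>z\<^sub>n\<close>.
  A quasi-isometric embedding cannot send the point \<open>p\<^sub>n = (z\<^sub>n, (n + 1)!)\<close> to a place with less
  branching, which rules out the features of index \<open>m < n\<close>; it distorts heights at most linearly,
  which rules out \<open>m > n\<close> since the scales are so sparse. Hence it sends \<open>p\<^sub>n\<close> close to the direction
  \<open>z\<^sub>n\<close> for all large \<open>n\<close>, so it fixes the boundary and is coarsely surjective.\<close>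

section \<open>The hyperbolic cone\<close>

text \<open>The obstacle is self-similarity: with the Euclidean metric, x -> x / 3 maps the carpet
  into itself and induces the isometric embedding (x, s) -> (x / 3, s + ln 3) of the cone, which is
  not coarsely surjective. The metric has to destroy all such maps. The comparison of branching is a
  pigeonhole count. Write D_n = (n + 1)!. An embedding with constants l and C sends height D_n to
  height at most l D_n + O(1), which is well below n D_n once n is large compared with l, C and the
  additive constants. The next feature has size exp (- D_(n+1)) = exp (- (n + 2) D_n) and is
  invisible at that height. The Euclidean metric and the earlier features together are Lipschitz
  with a constant fixed before stage n, so at the visible scales M_n classes of points describe
  them. Stage n then plants more than n M_n separated points; the factor n outgrows the number of
  relative heights of their images for every l and C. Two separated images thus share a class and
  nearly a height, and only feature n can keep them apart.\<close>

lemma sum_power_le: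
  fixes r :: real
  assumes "0 < r" "r < 1" and "finite A" and "inj_on g A"
  shows "(\<Sum>i\<in>A. r ^ g i) \<le> 1 / (1 - r)"
proof -
  have "(\<Sum>i\<in>A. r ^ g i) = (\<Sum>k\<in>g ` A. r ^ k)"
    using assms by (simp add: sum.reindex)
  also have "\<dots> \<le> (\<Sum>k. r ^ k)"
    using assms by (intro sum_le_suminf summable_geometric) auto
  finally show ?thesis using assms by (simp add: suminf_geometric)
qed

text \<open>On either side of \<open>j\<close> the exponent is injective, so each side is at most a
  full geometric series.\<close>

lemma sum_power_dist_le:
  fixes r :: real
  assumes r: "0 < r" "r < 1"
  shows "(\<Sum>i<N. r ^ nat \<bar>int i - int j\<bar>) \<le> 2 / (1 - r)"
proof -
  have "(\<Sum>i<N. r ^ nat \<bar>int i - int j\<bar>) =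
      (\<Sum>i\<in>{..<N} \<inter> {..j}. r ^ nat \<bar>int i - int j\<bar>) + (\<Sum>i\<in>{..<N} - {..j}. r ^ nat \<bar>int i - int j\<bar>)"
    by (rule sum.Int_Diff) simp
  also have "\<dots> \<le> 1 / (1 - r) + 1 / (1 - r)"
    by (intro add_mono sum_power_le r) (auto simp: inj_on_def)
  finally show ?thesis by simp
qed

text \<open>\<open>dist\<close> provides the compact topology of \<open>Z\<close>; the geometry of
  the cone comes from \<open>\<rho>\<close>. By \<open>fine\<close> the identity is continuous from
  \<open>dist\<close> to \<open>\<rho>\<close>, so on compact \<open>Z\<close> both induce the same
  topology. Points are handled through \<open>pt\<close>, \<open>\<pi>\<close> and \<open>ht\<close>
  instead of pairs so that the cone can be realised inside another type.\<close>

locale boundary_cone =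
  fixes Z :: "'a::metric_space set" and \<rho> :: "'a \<Rightarrow> 'a \<Rightarrow> real" and B :: real
    and X :: "'p set" and pt :: "'a \<Rightarrow> real \<Rightarrow> 'p" and \<pi> :: "'p \<Rightarrow> 'a" and ht :: "'p \<Rightarrow> real"
  assumes metric: "Metric_space Z \<rho>"
    and bounded: "\<And>x y. x \<in> Z \<Longrightarrow> y \<in> Z \<Longrightarrow> \<rho> x y \<le> B"
    and compact: "compact Z" and nonempty: "Z \<noteq> {}"
    and fine: "\<And>e. e > 0 \<Longrightarrow> \<exists>\<delta>>0. \<forall>x\<in>Z. \<forall>y\<in>Z. dist x y < \<delta> \<longrightarrow> \<rho> x y < e"
    and X_eq: "X = (\<lambda>(x, s). pt x s) ` (Z \<times> {0..})"
    and base_pt: "\<And>x s. x \<in> Z \<Longrightarrow> s \<ge> 0 \<Longrightarrow> \<pi> (pt x s) = x"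
    and ht_pt: "\<And>x s. x \<in> Z \<Longrightarrow> s \<ge> 0 \<Longrightarrow> ht (pt x s) = s"
begin

interpretation Z: Metric_space Z \<rho> by (rule metric)

lemma pt_in: "x \<in> Z \<Longrightarrow> s \<ge> 0 \<Longrightarrow> pt x s \<in> X"
  unfolding X_eq by force

lemma X_cases:
  assumes "p \<in> X"
  obtains "\<pi> p \<in> Z" "ht p \<ge> 0" "p = pt (\<pi> p) (ht p)"
  using assms base_pt ht_pt unfolding X_eq by auto

lemma base_in: "p \<in> X \<Longrightarrow> \<pi> p \<in> Z" and ht_nonneg: "p \<in> X \<Longrightarrow> ht p \<ge> 0"
  by (erule X_cases; simp)+

lemma B_nonneg: "B \<ge> 0"
  using nonempty bounded Z.nonneg order_trans by blast

text \<open>Plays the part of \<open>exp (- (p | q))\<close>: seen from a fixed base point, the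
  Gromov product is \<open>- ln (\<theta> p q)\<close> up to a bounded error.\<close>

definition \<theta> :: "'p \<Rightarrow> 'p \<Rightarrow> real"
  where "\<theta> p q = \<rho> (\<pi> p) (\<pi> q) + exp (- min (ht p) (ht q))"

definition d :: "'p \<Rightarrow> 'p \<Rightarrow> real"
  where "d p q = ht p + ht q + 2 * ln (\<theta> p q)"

lemma \<theta>_pos [simp]: "\<theta> p q > 0"
  unfolding \<theta>_def by (intro add_nonneg_pos) auto

lemma \<theta>_nonzero [simp]: "\<theta> p q \<noteq> 0"
  using \<theta>_pos by (metis less_irrefl)

lemma \<theta>_commute: "\<theta> p q = \<theta> q p"
  unfolding \<theta>_def by (simp add: Z.commute min.commute)

lemma \<theta>_ge: "\<theta> p q \<ge> exp (- ht p)" "\<theta> p q \<ge> exp (- ht q)"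
  unfolding \<theta>_def using Z.nonneg[of "\<pi> p" "\<pi> q"]
  by (smt (verit) exp_le_cancel_iff)+

lemma \<theta>_le:
  assumes "p \<in> X" "q \<in> X" shows "\<theta> p q \<le> B + 1"
  unfolding \<theta>_def using bounded[of "\<pi> p" "\<pi> q"] assms base_in ht_nonneg
  by (intro add_mono) auto

lemma \<theta>_triangle:
  assumes "p \<in> X" "q \<in> X" "r \<in> X"
  shows "\<theta> p r \<le> \<theta> p q + \<theta> q r"
proof -
  have "\<rho> (\<pi> p) (\<pi> r) \<le> \<rho> (\<pi> p) (\<pi> q) + \<rho> (\<pi> q) (\<pi> r)"
    using assms base_in Z.triangle by blast
  moreover have "exp (- min (ht p) (ht r)) \<le> exp (- min (ht p) (ht q)) + exp (- min (ht q) (ht r))"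
  proof (cases "ht p \<le> ht r")
    case True
    then have "exp (- min (ht p) (ht r)) \<le> exp (- min (ht p) (ht q))" by simp
    then show ?thesis by (smt (verit) exp_gt_zero)
  next
    case False
    then have "exp (- min (ht p) (ht r)) \<le> exp (- min (ht q) (ht r))" by simp
    then show ?thesis by (smt (verit) exp_gt_zero)
  qed
  ultimately show ?thesis unfolding \<theta>_def by linarith
qed

text \<open>The triangle inequality for \<open>d\<close> in exponential form. Both exponentials on
  the right are at least \<open>exp (- ht q)\<close>, so the mixed terms of the expanded product
  dominate the \<open>\<rho>\<close> part of the left side and the product of the exponentials
  dominates the rest.\<close>

lemma \<theta>_mult:
  assumes "p \<in> X" "q \<in> X" "r \<in> X"
  shows "\<theta> p r * exp (- ht q) \<le> \<theta> p q * \<theta> q r"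
proof -
  let ?a = "\<rho> (\<pi> p) (\<pi> q)" and ?b = "\<rho> (\<pi> q) (\<pi> r)" and ?h = "exp (- ht q)"
  let ?m = "exp (- min (ht p) (ht q))" and ?n = "exp (- min (ht q) (ht r))"
  have t: "\<rho> (\<pi> p) (\<pi> r) \<le> ?a + ?b"
    using assms base_in Z.triangle by blast
  have mh: "?m \<ge> ?h" "?n \<ge> ?h" by auto
  have "exp (- min (ht p) (ht r)) * ?h \<le> ?m * ?n"
    unfolding exp_add[symmetric] by auto
  moreover have "?a * ?h \<le> ?a * ?n" by (intro mult_left_mono mh) simp
  moreover have "?h * ?b \<le> ?m * ?b" by (intro mult_right_mono mh) simp
  moreover have "?a * ?b \<ge> 0" by simp
  moreover have "\<rho> (\<pi> p) (\<pi> r) * ?h \<le> (?a + ?b) * ?h"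
    using t by (intro mult_right_mono) auto
  ultimately show ?thesis unfolding \<theta>_def ring_distribs by (smt (verit) mult.commute)
qed

lemma abs_ht_le_d: "\<bar>ht p - ht q\<bar> \<le> d p q"
proof -
  have "ln (exp (- min (ht p) (ht q))) \<le> ln (\<theta> p q)"
    by (subst ln_le_cancel_iff) (simp_all, simp add: \<theta>_def)
  then show ?thesis unfolding d_def by auto
qed

lemma d_commute: "d p q = d q p"
  unfolding d_def by (simp add: \<theta>_commute)

lemma d_nonneg: "d p q \<ge> 0"
  using abs_ht_le_d[of p q] by linarith

lemma d_triangle:
  assumes "p \<in> X" "q \<in> X" "r \<in> X"
  shows "d p r \<le> d p q + d q r"
proof -
  have "ln (\<theta> p r * exp (- ht q)) \<le> ln (\<theta> p q * \<theta> q r)"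
    using \<theta>_mult[OF assms] \<theta>_pos by (subst ln_le_cancel_iff) auto
  then show ?thesis unfolding d_def by (simp add: ln_mult)
qed

lemma d_pt_same: "x \<in> Z \<Longrightarrow> s \<ge> 0 \<Longrightarrow> t \<ge> 0 \<Longrightarrow> d (pt x s) (pt x t) = \<bar>s - t\<bar>"
  unfolding d_def \<theta>_def by (simp add: base_pt ht_pt)

lemma Metric_space_cone: "Metric_space X d"
proof
  fix p q assume p: "p \<in> X" and q: "q \<in> X"
  show "d p q = 0 \<longleftrightarrow> p = q"
  proof
    assume 0: "d p q = 0"
    have ht: "ht p = ht q" using abs_ht_le_d[of p q] 0 by linarith
    then have "ln (\<theta> p q) = - ht q" using 0 unfolding d_def by linarith
    then have "\<theta> p q = exp (- ht q)" using \<theta>_pos by (metis exp_ln)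
    then have "\<rho> (\<pi> p) (\<pi> q) = 0" unfolding \<theta>_def ht by simp
    then have "\<pi> p = \<pi> q" using p q base_in Z.zero by blast
    then show "p = q" using ht p q X_cases by metis
  next
    assume "p = q"
    then show "d p q = 0"
      using p by (metis X_cases abs_zero d_pt_same diff_self)
  qed
qed (auto simp: d_nonneg d_commute d_triangle)

lemma d_le:
  assumes "\<theta> p q \<le> c" shows "d p q \<le> ht p + ht q + 2 * ln c"
proof -
  have "ln (\<theta> p q) \<le> ln c" using assms \<theta>_pos[of p q] by (subst ln_le_cancel_iff) linarith+
  then show ?thesis unfolding d_def by simp
qed

lemma \<theta>_le_exp:
  assumes "d p q \<le> R" shows "\<theta> p q \<le> exp ((R - ht p - ht q) / 2)"
proof -
  have "ln (\<theta> p q) \<le> (R - ht p - ht q) / 2" using assms unfolding d_def by simp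
  then show ?thesis by (metis \<theta>_pos exp_ln exp_le_cancel_iff)
qed

section \<open>Gromov products and the chain inequality\<close>

lemma Gromov_product_eq:
  "Gromov_product d v p q = ht v + ln (\<theta> p v) + ln (\<theta> q v) - ln (\<theta> p q)"
  unfolding Gromov_product_def d_def by simp

text \<open>The inversion of \<open>\<theta>\<close> at \<open>v\<close>, as for metrics. Up to the
  factor \<open>exp (- ht v)\<close> it is the exponential of minus the Gromov product based at
  \<open>v\<close>, so it moves estimates for \<open>\<theta>\<close> to an arbitrary base point
  with no loss depending on that point.\<close>

definition inv_\<theta> :: "'p \<Rightarrow> 'p \<Rightarrow> 'p \<Rightarrow> real"
  where "inv_\<theta> v p q = \<theta> p q / (\<theta> p v * \<theta> q v)"

lemma exp_Gromov_product: "exp (- Gromov_product d v p q) = exp (- ht v) * inv_\<theta> v p q"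
proof -
  have "- Gromov_product d v p q = - ht v + ln (inv_\<theta> v p q)"
    unfolding Gromov_product_eq inv_\<theta>_def by (simp add: ln_div ln_mult)
  then show ?thesis
    by (simp only: exp_add) (simp add: inv_\<theta>_def)
qed

lemma inv_\<theta>_nonneg: "inv_\<theta> v p q \<ge> 0"
  unfolding inv_\<theta>_def using \<theta>_pos by (simp add: less_imp_le)

text \<open>The triangle inequality for \<open>\<theta>\<close> divided by
  \<open>\<theta> p v * \<theta> q v\<close>: the function \<open>1 / \<theta> p v\<close> of
  \<open>p\<close> is 1-Lipschitz for \<open>inv_\<theta>\<close>.\<close>

lemma inv_\<theta>_step:
  assumes "p \<in> X" "q \<in> X" "v \<in> X"
  shows "\<bar>1 / \<theta> p v - 1 / \<theta> q v\<bar> \<le> inv_\<theta> v p q"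
proof -
  have "\<theta> p v \<le> \<theta> p q + \<theta> q v" "\<theta> q v \<le> \<theta> p q + \<theta> p v"
    using \<theta>_triangle[of p q v] \<theta>_triangle[of q p v] assms \<theta>_commute[of p q] by auto
  then have "\<bar>\<theta> q v - \<theta> p v\<bar> \<le> \<theta> p q" by linarith
  moreover have "1 / \<theta> p v - 1 / \<theta> q v = (\<theta> q v - \<theta> p v) / (\<theta> p v * \<theta> q v)"
    using \<theta>_pos[of p v] \<theta>_pos[of q v] by (simp add: field_simps)
  ultimately show ?thesis unfolding inv_\<theta>_def
    using \<theta>_pos[of p v] \<theta>_pos[of q v]
    by (auto simp: abs_divide abs_mult abs_of_pos intro!: divide_right_mono less_imp_le[OF mult_pos_pos])
qed

text \<open>Either the whole chain is so close to \<open>v\<close> that \<open>inv_\<theta>\<close> is comparable to a multiple of \<open>\<theta>\<close> along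
  it, or \<open>1 / \<theta> (a i) v\<close> drops by half its initial value somewhere on the way.\<close>

lemma inv_\<theta>_chain:
  assumes a: "\<And>i. i \<le> N \<Longrightarrow> a i \<in> X" and N: "N > 0" and v: "v \<in> X"
  shows "inv_\<theta> v (a 0) (a N) \<le> 4 * (\<Sum>i<N. inv_\<theta> v (a i) (a (Suc i)))" (is "_ \<le> 4 * ?S")
proof -
  \<comment> \<open>The endpoint closer to \<open>v\<close> sets the scale; the cases below ask
    whether the chain ever leaves the region of twice that size.\<close>
  define c where "c = min (\<theta> (a 0) v) (\<theta> (a N) v)"
  have c: "c > 0" unfolding c_def by (simp add: \<theta>_pos)
  have telescope: "\<bar>1 / \<theta> (a j) v - 1 / \<theta> (a k) v\<bar> \<le> (\<Sum>i=j..<k. inv_\<theta> v (a i) (a (Suc i)))"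
    if "j \<le> k" "k \<le> N" for j k
    using that
  proof (induction k)
    case (Suc k)
    show ?case
    proof (cases "j = Suc k")
      case False
      then have "\<bar>1 / \<theta> (a j) v - 1 / \<theta> (a k) v\<bar> \<le> (\<Sum>i=j..<k. inv_\<theta> v (a i) (a (Suc i)))"
        using Suc by auto
      moreover have "\<bar>1 / \<theta> (a k) v - 1 / \<theta> (a (Suc k)) v\<bar> \<le> inv_\<theta> v (a k) (a (Suc k))"
        using a Suc.prems v by (intro inv_\<theta>_step) auto
      ultimately show ?thesis using False Suc.prems by (simp add: sum.atLeastLessThan_Suc)
    qed simp
  qed simp
  have telescope': "\<bar>1 / \<theta> (a j) v - 1 / \<theta> (a k) v\<bar> \<le> ?S" if "j \<le> k" "k \<le> N" for j k
    by (rule order_trans[OF telescope[OF that]], rule sum_mono2) (use that in \<open>auto simp: inv_\<theta>_nonneg\<close>)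
  show ?thesis
  proof (cases "\<forall>i\<le>N. \<theta> (a i) v \<le> 2 * c")
    case True
    have path: "\<theta> (a 0) (a k) \<le> (\<Sum>i<k. \<theta> (a i) (a (Suc i)))" if "0 < k" "k \<le> N" for k
      using that
    proof (induction k)
      case (Suc k)
      show ?case
      proof (cases "k = 0")
        case False
        have "\<theta> (a 0) (a (Suc k)) \<le> \<theta> (a 0) (a k) + \<theta> (a k) (a (Suc k))"
          using a Suc.prems by (intro \<theta>_triangle) auto
        then show ?thesis using Suc False by simp
      qed simp
    qed simp
    have "inv_\<theta> v (a 0) (a N) \<le> \<theta> (a 0) (a N) / (c * c)"
      unfolding inv_\<theta>_def c_def
      by (intro divide_left_mono mult_mono mult_pos_pos) (auto simp: \<theta>_pos less_imp_le)
    also have "\<dots> \<le> (\<Sum>i<N. \<theta> (a i) (a (Suc i))) / (c * c)"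
      using path[of N] N c by (intro divide_right_mono) auto
    \<comment> \<open>Replacing \<open>c\<close> by the bound \<open>2 * c\<close> for both
      denominators costs the factor 4.\<close>
    also have "\<dots> = 4 * (\<Sum>i<N. \<theta> (a i) (a (Suc i)) / ((2 * c) * (2 * c)))"
      using c by (simp add: sum_divide_distrib sum_distrib_left field_simps)
    also have "\<dots> \<le> 4 * ?S"
      unfolding inv_\<theta>_def using True c
      by (intro mult_left_mono sum_mono divide_left_mono mult_mono mult_pos_pos)
        (auto simp: \<theta>_pos less_imp_le)
    finally show ?thesis .
  next
    case False
    then obtain j where j: "j \<le> N" "\<theta> (a j) v > 2 * c" by auto
    have "1 / \<theta> (a j) v \<le> 1 / (2 * c)" using j c by (intro divide_left_mono) auto
    \<comment> \<open>The telescope runs between \<open>j\<close> and whichever endpoint attains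
      \<open>c\<close>.\<close>
    moreover have "1 / c - 1 / \<theta> (a j) v \<le> ?S"
      using telescope'[of 0 j] telescope'[of j N] j unfolding c_def min_def
      by (auto split: if_splits)
    moreover have "1 / c = 2 * (1 / (2 * c))" by simp
    ultimately have half: "1 / c \<le> 2 * ?S" by linarith
    have "inv_\<theta> v (a 0) (a N) \<le> (\<theta> (a 0) v + \<theta> (a N) v) / (\<theta> (a 0) v * \<theta> (a N) v)"
      unfolding inv_\<theta>_def using \<theta>_triangle[of "a 0" v "a N"] a[of 0] a[of N] v N \<theta>_pos
      by (intro divide_right_mono) (auto simp: \<theta>_commute[of v] less_imp_le)
    also have "\<dots> = 1 / \<theta> (a N) v + 1 / \<theta> (a 0) v"
      using \<theta>_pos[of "a 0" v] \<theta>_pos[of "a N" v] by (simp add: field_simps)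
    also have "\<dots> \<le> 1 / c + 1 / c"
      unfolding c_def by (intro add_mono divide_left_mono) (auto simp: \<theta>_pos)
    finally show ?thesis using half by simp
  qed
qed

text \<open>The chain inequality for two steps: the factor 4 times two terms gives the constant
  \<open>ln 8\<close>.\<close>

lemma four_point:
  assumes "p \<in> X" "q \<in> X" "r \<in> X" "v \<in> X"
  shows "min (Gromov_product d v p q) (Gromov_product d v q r) - ln 8 \<le> Gromov_product d v p r"
proof -
  let ?m = "min (Gromov_product d v p q) (Gromov_product d v q r)"
  define a where "a = (\<lambda>i::nat. if i = 0 then p else if i = 1 then q else r)"
  have "inv_\<theta> v (a 0) (a 2) \<le> 4 * (\<Sum>i<2. inv_\<theta> v (a i) (a (Suc i)))"
    using assms by (intro inv_\<theta>_chain) (auto simp: a_def)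
  then have "inv_\<theta> v p r \<le> 4 * (inv_\<theta> v p q + inv_\<theta> v q r)"
    by (simp add: a_def numeral_2_eq_2)
  then have "exp (- ht v) * inv_\<theta> v p r \<le> exp (- ht v) * (4 * (inv_\<theta> v p q + inv_\<theta> v q r))"
    by (intro mult_left_mono) auto
  then have "exp (- Gromov_product d v p r) \<le> 4 * (exp (- Gromov_product d v p q) + exp (- Gromov_product d v q r))"
    unfolding exp_Gromov_product by (simp add: algebra_simps)
  also have "\<dots> \<le> 4 * (exp (- ?m) + exp (- ?m))"
    by (intro mult_left_mono add_mono) auto
  also have "\<dots> = exp (ln 8 - ?m)" by (simp add: exp_diff exp_minus field_simps)
  finally show ?thesis by simp
qed

section \<open>Rough geodesics and visual rays\<close>

lemma qi_embedding_1I: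
  assumes "C \<ge> 0" "\<And>u. u \<in> S \<Longrightarrow> i u \<in> X"
    and "\<And>u u'. u \<in> S \<Longrightarrow> u' \<in> S \<Longrightarrow> u \<le> u' \<Longrightarrow> \<bar>d (i u) (i u') - (u' - u)\<bar> \<le> C"
  shows "qi_embedding_with 1 C S dist X d i"
  unfolding qi_embedding_with_def
proof (intro conjI ballI)
  fix u u' assume "u \<in> S" "u' \<in> S"
  then have "\<bar>d (i u) (i u') - dist u u'\<bar> \<le> C"
    using assms(3)[of u u'] assms(3)[of u' u]
    by (cases "u \<le> u'") (auto simp: dist_real_def d_commute)
  then show "1 / 1 * dist u u' - C \<le> d (i u) (i u')" "d (i u) (i u') \<le> 1 * dist u u' + C"
    by auto
qed (use assms in auto)

text \<open>Descend over \<open>x\<close> to the level \<open>g\<close> where the vertical rays over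
  \<open>x\<close> and \<open>y\<close> come within bounded distance, jump across, and climb over
  \<open>y\<close>.\<close>

lemma roughly_geodesic_cone: "roughly_geodesic X d"
  unfolding roughly_geodesic_def
proof (rule exI[of _ "1 + 2 * ln (B + 2)"], intro conjI ballI)
  show C0: "1 + 2 * ln (B + 2) \<ge> 0" using B_nonneg by simp
  fix p q assume p: "p \<in> X" and q: "q \<in> X"
  define x y s t where "x = \<pi> p" and "y = \<pi> q" and "s = ht p" and "t = ht q"
  have xy: "x \<in> Z" "y \<in> Z" and st: "s \<ge> 0" "t \<ge> 0" and pq: "p = pt x s" "q = pt y t"
    using p q X_cases unfolding x_def y_def s_def t_def by metis+
  \<comment> \<open>The Gromov product \<open>- ln (\<theta> p q)\<close>, cut off at 0 because
    heights are nonnegative. The factor \<open>B + 1\<close> in \<open>\<rho>_le_g\<close> pays for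
    the cut-off.\<close>
  define g where "g = max 0 (- ln (\<theta> p q))"
  have "exp (- min s t) \<le> \<theta> p q"
    using \<theta>_ge(1)[of p q] \<theta>_ge(2)[of q p] unfolding s_def t_def by (auto simp: min_def)
  then have "- min s t \<le> ln (\<theta> p q)"
    using \<theta>_pos[of p q] by (metis exp_ln exp_le_cancel_iff)
  then have g: "0 \<le> g" "g \<le> s" "g \<le> t" unfolding g_def using st by auto
  have "- g \<le> ln (\<theta> p q)" unfolding g_def by simp
  then have \<theta>_ge_g: "exp (- g) \<le> \<theta> p q"
    using \<theta>_pos[of p q] by (metis exp_ln exp_le_cancel_iff)
  have \<rho>_le_g: "\<rho> x y \<le> (B + 1) * exp (- g)"
  proof (cases "0 \<le> - ln (\<theta> p q)")
    case True
    then have "exp (- g) = \<theta> p q" unfolding g_def by simp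
    then have "\<rho> x y \<le> 1 * exp (- g)" unfolding \<theta>_def x_def y_def by simp
    also have "\<dots> \<le> (B + 1) * exp (- g)" using B_nonneg by (intro mult_right_mono) auto
    finally show ?thesis .
  next
    case False
    then show ?thesis using bounded[OF xy] unfolding g_def by simp
  qed
  \<comment> \<open>The extra unit of time is spent at level \<open>g\<close> over \<open>y\<close>,
    by the \<open>max\<close> in \<open>i\<close>. Without it the path would end over
    \<open>x\<close> when \<open>t = g\<close>.\<close>
  define L where "L = s + t - 2 * g + 1"
  define i where "i u = (if u \<le> s - g then pt x (s - u) else pt y (max g (u - 1 - s + 2 * g)))" for u
  have "rough_segment X d (1 + 2 * ln (B + 2)) p q 0 L i"
    unfolding rough_segment_def
  proof (intro conjI qi_embedding_1I C0)
    show "0 \<le> L" unfolding L_def using g by simp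
    show "i 0 = p" unfolding i_def using g pq by simp
    show "i L = q" unfolding i_def L_def using g pq by (auto simp: max_def)
    show "i u \<in> X" if "u \<in> {0..L}" for u
      using that g xy unfolding i_def by (auto intro!: pt_in)
    fix u u' assume u: "u \<in> {0..L}" "u' \<in> {0..L}" "u \<le> u'"
    have ln: "ln (B + 2) \<ge> 0" using B_nonneg by simp
    consider "u' \<le> s - g" | "s - g < u" | "u \<le> s - g" "s - g < u'" by linarith
    then show "\<bar>d (i u) (i u') - (u' - u)\<bar> \<le> 1 + 2 * ln (B + 2)"
    proof cases
      case 1
      then show ?thesis using u g xy ln unfolding i_def by (simp add: d_pt_same)
    next
      case 2
      then show ?thesis using u g xy ln unfolding i_def by (auto simp: d_pt_same max_def)
    next
      case 3
      define s' v where "s' = s - u" and "v = max g (u' - 1 - s + 2 * g)"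
      have i: "i u = pt x s'" "i u' = pt y v" unfolding i_def s'_def v_def using 3 by auto
      have s': "g \<le> s'" "s' \<le> s" and v: "g \<le> v" "v \<le> t"
        unfolding s'_def v_def using u g 3 by (auto simp: L_def)
      have \<theta>i: "\<theta> (i u) (i u') = \<rho> x y + exp (- min s' v)"
        unfolding i \<theta>_def using s' v g xy by (simp add: base_pt ht_pt)
      have "\<theta> p q \<le> \<theta> (i u) (i u')"
        unfolding \<theta>i unfolding \<theta>_def x_def[symmetric] y_def[symmetric] s_def[symmetric] t_def[symmetric]
        using s' v by auto
      then have "exp (- g) \<le> \<theta> (i u) (i u')" using \<theta>_ge_g by linarith
      then have lo: "- g \<le> ln (\<theta> (i u) (i u'))"
        by (metis \<theta>_pos exp_ln exp_le_cancel_iff)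
      have "exp (- min s' v) \<le> exp (- g)" using s' v by auto
      then have "\<theta> (i u) (i u') \<le> (B + 2) * exp (- g)"
        unfolding \<theta>i using \<rho>_le_g ring_distribs(2)[of "B + 1" 1 "exp (- g)"]
        by (simp add: add.assoc del: exp_le_cancel_iff)
      then have "ln (\<theta> (i u) (i u')) \<le> ln ((B + 2) * exp (- g))"
        using B_nonneg by (subst ln_le_cancel_iff) auto
      then have hi: "ln (\<theta> (i u) (i u')) \<le> ln (B + 2) - g"
        using B_nonneg by (simp add: ln_mult)
      have "d (i u) (i u') = s' + v + 2 * ln (\<theta> (i u) (i u'))"
        unfolding d_def i using s' v g xy by (simp add: ht_pt)
      then show ?thesis using lo hi ln 3 g unfolding s'_def v_def by (auto simp: max_def abs_if)
    qed
  qed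
  then show "\<exists>a b i. rough_segment X d (1 + 2 * ln (B + 2)) p q a b i" by blast
qed

lemma visual_cone: "visual X d"
proof -
  obtain x0 where x0: "x0 \<in> Z" using nonempty by blast
  define w where "w = pt x0 0"
  have w: "w \<in> X" unfolding w_def using x0 by (simp add: pt_in)
  have C0: "1 + 2 * ln (B + 1) \<ge> 0" and lnB: "ln (B + 1) \<ge> 0" using B_nonneg by simp_all
  have "\<exists>a i. rough_ray X d (1 + 2 * ln (B + 1)) (a, i) \<and> i a = w \<and> p \<in> i ` {a..}" if p: "p \<in> X" for p
  proof -
    define x s where "x = \<pi> p" and "s = ht p"
    have x: "x \<in> Z" and s: "s \<ge> 0" and p_eq: "p = pt x s"
      using p X_cases unfolding x_def s_def by metis+
    \<comment> \<open>Parameter 0 is reserved for the base point; after it the ray waits over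
      \<open>x\<close> at level 0 until time 1, so that even \<open>s = 0\<close> is reached at a
      positive parameter, \<open>s + 1\<close>.\<close>
    define i where "i u = (if u \<le> 0 then w else pt x (max 0 (u - 1)))" for u :: real
    have "qi_embedding_with 1 (1 + 2 * ln (B + 1)) {0..} dist X d i"
    proof (intro qi_embedding_1I C0)
      show "i u \<in> X" for u unfolding i_def using w x by (auto intro!: pt_in)
      fix u u' :: real assume u: "u \<in> {0..}" "u' \<in> {0..}" "u \<le> u'"
      consider "u' = 0" | "u > 0" | "u = 0" "u' > 0" using u by fastforce
      then show "\<bar>d (i u) (i u') - (u' - u)\<bar> \<le> 1 + 2 * ln (B + 1)"
      proof cases
        case 1
        then show ?thesis using u x0 lnB unfolding i_def w_def by (simp add: d_pt_same)
      next
        case 2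
        then show ?thesis using u x lnB unfolding i_def by (auto simp: d_pt_same max_def)
      next
        case 3
        have "ht w = 0" "ht (i u') = max 0 (u' - 1)"
          unfolding w_def i_def using x0 x 3 by (simp_all add: ht_pt)
        moreover have "i u' \<in> X" unfolding i_def using w x by (auto intro!: pt_in)
        ultimately have "d w (i u') \<le> max 0 (u' - 1) + 2 * ln (B + 1)" "d w (i u') \<ge> max 0 (u' - 1)"
          using d_le[OF \<theta>_le, of w "i u'"] abs_ht_le_d[of w "i u'"] w by auto
        then have "\<bar>d w (i u') - u'\<bar> \<le> 1 + 2 * ln (B + 1)" using 3(2) lnB by linarith
        moreover have "i u = w" unfolding i_def using 3 by simp
        ultimately show ?thesis using 3(1) by simp
      qed
    qed
    moreover have "i (s + 1) = p" unfolding i_def p_eq using s by simp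
    then have "p \<in> i ` {0..}" using s by (intro image_eqI[of _ _ "s + 1"]) auto
    ultimately show ?thesis
      unfolding rough_ray_def by (intro exI[of _ "0::real"] exI[of _ i]) (simp add: i_def)
  qed
  then show ?thesis unfolding visual_def
    by (rule_tac bexI[OF _ w], rule_tac exI[of _ "1 + 2 * ln (B + 1)"], intro conjI[OF C0] ballI)
qed

section \<open>Thin triangles from the four-point inequality\<close>

lemma qi_embedding_1D:
  assumes "qi_embedding_with 1 C S dist X d i"
  shows "C \<ge> 0" "\<And>u. u \<in> S \<Longrightarrow> i u \<in> X"
    and "\<And>u u'. u \<in> S \<Longrightarrow> u' \<in> S \<Longrightarrow> u \<le> u' \<Longrightarrow>
        u' - u - C \<le> d (i u) (i u') \<and> d (i u) (i u') \<le> u' - u + C"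
proof -
  fix u u' assume u: "u \<in> S" "u' \<in> S" "u \<le> u'"
  have "dist u u' - C \<le> d (i u) (i u') \<and> d (i u) (i u') \<le> dist u u' + C"
    using assms u(1,2) unfolding qi_embedding_with_def by simp
  then show "u' - u - C \<le> d (i u) (i u') \<and> d (i u) (i u') \<le> u' - u + C"
    using u(3) by (simp add: dist_real_def)
qed (use assms in \<open>auto simp: qi_embedding_with_def\<close>)

text \<open>Take the point \<open>y\<close> of the segment at distance about \<open>G\<close>, the
  product of \<open>x\<close> and \<open>r\<close> at \<open>p\<close>. The products at
  \<open>p\<close> of \<open>x\<close> with \<open>r\<close> and of \<open>r\<close> with
  \<open>y\<close> are then almost \<open>G\<close>, hence so is that of \<open>x\<close> with
  \<open>y\<close>, and \<open>d x y\<close> is about \<open>d x p - G\<close>, the product of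
  \<open>p\<close> and \<open>r\<close> at \<open>x\<close>.\<close>

lemma rough_segment_near:
  assumes seg: "rough_segment X d C p r a b i" and p: "p \<in> X" and x: "x \<in> X"
    and K: "Gromov_product d x p r \<le> K"
  shows "\<exists>y\<in>i ` {a..b}. d x y \<le> K + 6 * C + 2 * ln 8"
proof -
  have ab: "a \<le> b" and ends: "i a = p" "i b = r" and qi: "qi_embedding_with 1 C {a..b} dist X d i"
    using seg unfolding rough_segment_def by auto
  note C = qi_embedding_1D(1)[OF qi] and iX = qi_embedding_1D(2)[OF qi] and rough = qi_embedding_1D(3)[OF qi]
  have r: "r \<in> X" using iX[of b] ab ends by auto
  define G where "G = Gromov_product d p x r"
  have G: "G \<ge> 0" "G \<le> d p r"
    unfolding G_def Gromov_product_def
    using d_triangle[of x p r] d_triangle[of x r p] d_triangle[of r x p] p x r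
    by (auto simp: d_commute)
  \<comment> \<open>\<open>a + G\<close> may overshoot \<open>b\<close> by up to
    \<open>C\<close>.\<close>
  define u where "u = min b (a + G)"
  have u: "u \<in> {a..b}" unfolding u_def using ab G by auto
  define y where "y = i u"
  have y: "y \<in> X" unfolding y_def using iX u by blast
  have pr: "b - a - C \<le> d p r" "d p r \<le> b - a + C" using rough[of a b] ab ends by auto
  have py: "d y p \<le> u - a + C" "u - a - C \<le> d y p" using rough[of a u] u ends unfolding y_def by (auto simp: d_commute)
  have ry: "d r y \<le> b - u + C" using rough[of u b] u ends unfolding y_def by (auto simp: d_commute)
  have ua: "G - C \<le> u - a" "u - a \<le> G" unfolding u_def using G pr C by auto
  have "Gromov_product d p r y \<ge> G - 5 * C / 2"
    unfolding Gromov_product_def using pr py ry ua by (simp add: d_commute[of r p])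
  then have "Gromov_product d p x y \<ge> G - 5 * C / 2 - ln 8"
    using four_point[OF x r y p] C unfolding G_def by linarith
  moreover have "d x p = G + Gromov_product d x p r"
    unfolding G_def Gromov_product_def
    by (simp add: d_commute[of p x] d_commute[of r p] d_commute[of r x] field_simps)
  ultimately have "d x y \<le> K + 6 * C + 2 * ln 8"
    unfolding Gromov_product_def[of d p x y] using py ua K by (simp add: field_simps)
  then show ?thesis using u unfolding y_def by blast
qed

text \<open>On the side from \<open>p\<close> to \<open>q\<close> the product of \<open>p\<close>
  and \<open>q\<close> at \<open>x\<close> is bounded. By the four-point inequality so is the
  product of \<open>r\<close> with one of them, and \<open>x\<close> is close to the corresponding
  side.\<close>

lemma rough_segment_thin:
  assumes seg: "rough_segment X d C p q a b i" and x: "x \<in> i ` {a..b}" and r: "r \<in> X"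
    and sides: "rough_segment X d C q r a2 b2 i2" "rough_segment X d C r p a3 b3 i3"
  shows "\<exists>y\<in>i2 ` {a2..b2} \<union> i3 ` {a3..b3}. d x y \<le> 8 * C + 3 * ln 8"
proof -
  obtain u where u: "u \<in> {a..b}" "x = i u" using x by blast
  have ab: "a \<le> b" and ends: "i a = p" "i b = q" and qi: "qi_embedding_with 1 C {a..b} dist X d i"
    using seg unfolding rough_segment_def by auto
  note C = qi_embedding_1D(1)[OF qi] and iX = qi_embedding_1D(2)[OF qi] and rough = qi_embedding_1D(3)[OF qi]
  have X: "p \<in> X" "q \<in> X" "x \<in> X" using iX[of a] iX[of b] iX[of u] ab ends u by auto
  have "Gromov_product d x p q \<le> 3 * C / 2"
    unfolding Gromov_product_def
    using rough[of a b] rough[of a u] rough[of u b] u ab ends by (auto simp: d_commute)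
  then have "min (Gromov_product d x p r) (Gromov_product d x r q) \<le> 3 * C / 2 + ln 8"
    using four_point[of p r q x] X r by linarith
  then consider "Gromov_product d x r p \<le> 3 * C / 2 + ln 8" | "Gromov_product d x q r \<le> 3 * C / 2 + ln 8"
    by (auto simp: min_le_iff_disj Gromov_product_def d_commute add.commute)
  then show ?thesis
  proof cases
    case 1
    obtain y where "y \<in> i3 ` {a3..b3}" "d x y \<le> 3 * C / 2 + ln 8 + 6 * C + 2 * ln 8"
      using rough_segment_near[OF sides(2) r X(3) 1] by blast
    then show ?thesis using C by (intro bexI[of _ y]) auto
  next
    case 2
    obtain y where "y \<in> i2 ` {a2..b2}" "d x y \<le> 3 * C / 2 + ln 8 + 6 * C + 2 * ln 8"
      using rough_segment_near[OF sides(1) X(2,3) 2] by blast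
    then show ?thesis using C by (intro bexI[of _ y]) auto
  qed
qed

lemma Gromov_hyperbolic_cone: "Gromov_hyperbolic X d"
  unfolding Gromov_hyperbolic_def
proof (intro allI impI)
  fix C :: real assume C: "C \<ge> 0"
  show "\<exists>\<delta>\<ge>0. \<forall>p q r a1 b1 i1 a2 b2 i2 a3 b3 i3.
       rough_segment X d C p q a1 b1 i1 \<longrightarrow>
       rough_segment X d C q r a2 b2 i2 \<longrightarrow>
       rough_segment X d C r p a3 b3 i3 \<longrightarrow>
         in_nbhd d \<delta> (i1 ` {a1..b1}) (i2 ` {a2..b2} \<union> i3 ` {a3..b3}) \<and>
         in_nbhd d \<delta> (i2 ` {a2..b2}) (i3 ` {a3..b3} \<union> i1 ` {a1..b1}) \<and>
         in_nbhd d \<delta> (i3 ` {a3..b3}) (i1 ` {a1..b1} \<union> i2 ` {a2..b2})"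
  proof (intro exI[of _ "8 * C + 3 * ln 8"] conjI allI impI)
    show "0 \<le> 8 * C + 3 * ln (8::real)" using C by simp
    fix p q r a1 b1 i1 a2 b2 i2 a3 b3 i3
    assume s: "rough_segment X d C p q a1 b1 i1" "rough_segment X d C q r a2 b2 i2"
       "rough_segment X d C r p a3 b3 i3"
    have X: "p \<in> X" "q \<in> X" "r \<in> X"
      using s unfolding rough_segment_def qi_embedding_with_def by (auto simp: Pi_iff)
    show "in_nbhd d (8 * C + 3 * ln 8) (i1 ` {a1..b1}) (i2 ` {a2..b2} \<union> i3 ` {a3..b3})"
      unfolding in_nbhd_def using rough_segment_thin[OF s(1) _ X(3) s(2,3)] by blast
    show "in_nbhd d (8 * C + 3 * ln 8) (i2 ` {a2..b2}) (i3 ` {a3..b3} \<union> i1 ` {a1..b1})"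
      unfolding in_nbhd_def using rough_segment_thin[OF s(2) _ X(1) s(3,1)] by blast
    show "in_nbhd d (8 * C + 3 * ln 8) (i3 ` {a3..b3}) (i1 ` {a1..b1} \<union> i2 ` {a2..b2})"
      unfolding in_nbhd_def using rough_segment_thin[OF s(3) _ X(2) s(1,2)] by blast
  qed
qed

section \<open>Stability of discrete quasi-geodesics\<close>

text \<open>If the chain stays at distance at least \<open>D\<close> from \<open>v\<close>, with equality at index \<open>j\<close>, then
  \<open>d (a i) v \<ge> max D (\<bar>i - j\<bar> / l - C - D)\<close>, so that the terms of the chain inequality add up to
  at most a constant times \<open>exp (- D / 3)\<close>.\<close>

lemma quasi_geodesic_near:
  assumes l: "l \<ge> 1"
  shows "\<exists>H. \<forall>a N v. N > 0 \<longrightarrow> v \<in> X \<longrightarrow> (\<forall>i\<le>N. a i \<in> X) \<longrightarrow>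
      (\<forall>i\<le>N. \<forall>j\<le>N. \<bar>real i - real j\<bar> / l - C \<le> d (a i) (a j)) \<longrightarrow>
      (\<forall>i<N. d (a i) (a (Suc i)) \<le> E) \<longrightarrow>
      Gromov_product d v (a 0) (a N) \<le> K \<longrightarrow> (\<exists>i\<le>N. d v (a i) \<le> H)"
proof -
  define r where "r = exp (- 1 / (3 * l))"
  have r: "0 < r" "r < 1" unfolding r_def using l by auto
  define H where "H = 3 * (K + E + C / 3 + ln (8 / (1 - r)))"
  have near: "\<exists>i\<le>N. d v (a i) \<le> H"
    if N: "N > 0" and v: "v \<in> X" and a: "\<And>i. i \<le> N \<Longrightarrow> a i \<in> X"
      and lower: "\<And>i j. i \<le> N \<Longrightarrow> j \<le> N \<Longrightarrow> \<bar>real i - real j\<bar> / l - C \<le> d (a i) (a j)"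
      and step: "\<And>i. i < N \<Longrightarrow> d (a i) (a (Suc i)) \<le> E"
      and K: "Gromov_product d v (a 0) (a N) \<le> K" for a N v
  proof -
    obtain j where j: "j \<le> N" and j_min: "\<And>i. i \<le> N \<Longrightarrow> d v (a j) \<le> d v (a i)"
      using ex_is_arg_min_if_finite[of "{..N}" "\<lambda>i. d v (a i)"]
      by (auto simp: is_arg_min_linorder)
    define D where "D = d v (a j)"
    have "exp (- Gromov_product d v (a i) (a (Suc i)))
        \<le> exp (E + C / 3 - D / 3) * r ^ nat \<bar>int i - int j\<bar>" if i: "i < N" for i
    proof -
      have "d (a i) v \<le> d (a i) (a (Suc i)) + d (a (Suc i)) v"
        using i a v by (intro d_triangle) auto
      then have G: "Gromov_product d v (a i) (a (Suc i)) \<ge> d (a i) v - E"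
        unfolding Gromov_product_def using step[OF i] by simp
      have "d (a i) (a j) \<le> d (a i) v + d v (a j)"
        using i j a v by (intro d_triangle) auto
      then have "\<bar>real i - real j\<bar> / l - C - D \<le> d (a i) v"
        using lower[of i j] i j unfolding D_def by auto
      moreover have "D \<le> d (a i) v" unfolding D_def using j_min[of i] i by (simp add: d_commute)
      \<comment> \<open>Two thirds of the second bound plus one third of the first. These weights
        leave decay both in \<open>D\<close> and in the distance of \<open>i\<close> from
        \<open>j\<close>.\<close>
      ultimately have "(D + \<bar>real i - real j\<bar> / l - C) / 3 \<le> d (a i) v" by simp
      moreover have "real (nat \<bar>int i - int j\<bar>) * (- 1 / (3 * l)) = - (\<bar>real i - real j\<bar> / l) / 3"
        by simp
      ultimately have "- Gromov_product d v (a i) (a (Suc i))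
          \<le> (E + C / 3 - D / 3) + real (nat \<bar>int i - int j\<bar>) * (- 1 / (3 * l))"
        using G by argo
      then have "exp (- Gromov_product d v (a i) (a (Suc i)))
          \<le> exp ((E + C / 3 - D / 3) + real (nat \<bar>int i - int j\<bar>) * (- 1 / (3 * l)))"
        by (simp only: exp_le_cancel_iff)
      then show ?thesis unfolding r_def by (simp only: exp_add exp_of_nat_mult)
    qed
    then have sum: "(\<Sum>i<N. exp (- Gromov_product d v (a i) (a (Suc i))))
        \<le> (\<Sum>i<N. exp (E + C / 3 - D / 3) * r ^ nat \<bar>int i - int j\<bar>)"
      by (intro sum_mono) auto
    have "exp (- K) \<le> exp (- Gromov_product d v (a 0) (a N))" using K by simp
    also have "\<dots> \<le> exp (- ht v) * (4 * (\<Sum>i<N. inv_\<theta> v (a i) (a (Suc i))))"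
      unfolding exp_Gromov_product using a N v by (intro mult_left_mono inv_\<theta>_chain) auto
    also have "\<dots> = 4 * (\<Sum>i<N. exp (- Gromov_product d v (a i) (a (Suc i))))"
      unfolding exp_Gromov_product by (simp add: sum_distrib_left mult_ac)
    also have "\<dots> \<le> 4 * (exp (E + C / 3 - D / 3) * (\<Sum>i<N. r ^ nat \<bar>int i - int j\<bar>))"
      using sum by (intro mult_left_mono) (simp_all add: sum_distrib_left)
    also have "\<dots> \<le> 4 * (exp (E + C / 3 - D / 3) * (2 / (1 - r)))"
      by (intro mult_left_mono sum_power_dist_le r) auto
    also have "\<dots> = exp (E + C / 3 - D / 3 + ln (8 / (1 - r)))"
      using r by (simp add: exp_add)
    finally have "D \<le> H" unfolding H_def by simp
    then show ?thesis using j unfolding D_def by blast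
  qed
  show ?thesis by (rule exI[of _ H], intro allI impI, rule near) simp_all
qed

subsection \<open>The boundary of the cone\<close>

text \<open>Convergence is required at the rate \<open>exp (- t)\<close>, with the parameter equal
  to the height up to a constant. This keeps the ray within bounded distance of the vertical ray
  over \<open>x\<close>, so that the endpoint determines its class.\<close>

definition tracks :: "real \<times> (real \<Rightarrow> 'p) \<Rightarrow> 'a \<Rightarrow> bool"
  where "tracks \<gamma> x \<longleftrightarrow> x \<in> Z \<and> \<gamma> \<in> rough_rays X d \<and>
    (\<exists>K>0. \<forall>t\<ge>fst \<gamma>. \<rho> (\<pi> (snd \<gamma> t)) x \<le> K * exp (- t) \<and> \<bar>ht (snd \<gamma> t) - t\<bar> \<le> K)"

definition boundary_class :: "'a \<Rightarrow> (real \<times> (real \<Rightarrow> 'p)) set"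
  where "boundary_class x = {\<gamma>. tracks \<gamma> x}"

lemma rough_rayD:
  assumes "(a, i) \<in> rough_rays X d"
  shows "\<exists>C\<ge>0. qi_embedding_with 1 C {a..} dist X d i"
  using assms unfolding rough_rays_def rough_ray_def by auto

lemma rough_rays_in: "(a, i) \<in> rough_rays X d \<Longrightarrow> t \<ge> a \<Longrightarrow> i t \<in> X"
  using rough_rayD qi_embedding_1D(2) by fastforce

text \<open>Heights along a rough ray grow at unit speed, so bounded roughness makes the base points
  Cauchy for \<open>\<rho>\<close> at an exponential rate. Compactness gives a limit point for
  \<open>dist\<close>, and \<open>fine\<close> carries the estimate over to it.\<close>

lemma rough_ray_tracks:
  assumes "\<gamma> \<in> rough_rays X d"
  shows "\<exists>x. tracks \<gamma> x"
proof -
  obtain a i where \<gamma>: "\<gamma> = (a, i)" by (cases \<gamma>)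
  obtain C where C: "qi_embedding_with 1 C {a..} dist X d i"
    using rough_rayD assms unfolding \<gamma> by blast
  note D = qi_embedding_1D[OF C]
  have C0: "C \<ge> 0" by (rule D(1))
  have iX: "\<And>t. t \<ge> a \<Longrightarrow> i t \<in> X" using D(2) by auto
  have lnB: "ln (B + 1) \<ge> 0" using B_nonneg by simp
  \<comment> \<open>Heights cannot grow faster than the distance from \<open>i a\<close>. They
    cannot lag behind either: that distance is at most the sum of the two heights plus
    \<open>2 * ln (B + 1)\<close>.\<close>
  define K1 where "K1 = ht (i a) + \<bar>a\<bar> + C + 2 * ln (B + 1)"
  have K1: "\<bar>ht (i t) - t\<bar> \<le> K1" if t: "t \<ge> a" for t
  proof -
    have "t - a - C \<le> d (i a) (i t)" "d (i a) (i t) \<le> t - a + C" using D(3)[of a t] t by auto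
    moreover have "d (i a) (i t) \<le> ht (i a) + ht (i t) + 2 * ln (B + 1)"
      using iX t by (intro d_le \<theta>_le) auto
    ultimately show ?thesis
      using abs_ht_le_d[of "i a" "i t"] lnB C0 ht_nonneg[OF iX[of a]] unfolding K1_def by auto
  qed
  define K2 where "K2 = exp (C / 2 + K1)"
  have K2: "\<rho> (\<pi> (i s)) (\<pi> (i t)) \<le> K2 * exp (- s)" if st: "a \<le> s" "s \<le> t" for s t
  proof -
    have "\<rho> (\<pi> (i s)) (\<pi> (i t)) \<le> \<theta> (i s) (i t)" unfolding \<theta>_def by simp
    also have "\<dots> \<le> exp (((t - s + C) - ht (i s) - ht (i t)) / 2)"
      using D(3)[of s t] st by (intro \<theta>_le_exp) auto
    also have "\<dots> \<le> exp ((C / 2 + K1) + (- s))"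
      using K1[of s] K1[of t] st by simp
    also have "\<dots> = K2 * exp (- s)" unfolding K2_def exp_add ..
    finally show ?thesis .
  qed
  have "\<forall>n. \<pi> (i (a + real n)) \<in> Z" using iX base_in by auto
  then obtain x r where x: "x \<in> Z" and r: "strict_mono (r :: nat \<Rightarrow> nat)"
    and lim: "((\<lambda>n. \<pi> (i (a + real n))) \<circ> r) \<longlonglongrightarrow> x"
    using compact unfolding compact_def by meson
  have lim_bound: "\<rho> (\<pi> (i s)) x \<le> K2 * exp (- s)" if s: "s \<ge> a" for s
  proof (rule field_le_epsilon)
    fix e :: real assume e: "e > 0"
    obtain \<delta> where \<delta>: "\<delta> > 0" "\<And>y z. y \<in> Z \<Longrightarrow> z \<in> Z \<Longrightarrow> dist y z < \<delta> \<Longrightarrow> \<rho> y z < e"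
      using fine[OF e] by blast
    have "\<forall>\<^sub>F n in sequentially. dist (\<pi> (i (a + real (r n)))) x < \<delta>"
      using tendstoD[OF lim \<delta>(1)] by simp
    moreover have "\<forall>\<^sub>F n in sequentially. n \<ge> nat \<lceil>s - a\<rceil>" by (rule eventually_ge_at_top)
    ultimately have "\<forall>\<^sub>F n in sequentially. dist (\<pi> (i (a + real (r n)))) x < \<delta> \<and> n \<ge> nat \<lceil>s - a\<rceil>"
      by (rule eventually_conj)
    then obtain n where n: "dist (\<pi> (i (a + real (r n)))) x < \<delta>" "n \<ge> nat \<lceil>s - a\<rceil>"
      by (metis (mono_tags, lifting) eventually_sequentially order_refl)
    have "real (r n) \<ge> real n" using r by (simp add: seq_suble)
    then have t: "a + real (r n) \<ge> s" using n(2) by linarith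
    have "\<rho> (\<pi> (i s)) x \<le> \<rho> (\<pi> (i s)) (\<pi> (i (a + real (r n)))) + \<rho> (\<pi> (i (a + real (r n)))) x"
      using iX base_in s x by (intro Z.triangle) auto
    also have "\<dots> \<le> K2 * exp (- s) + e"
      using K2[OF s t] \<delta>(2)[OF _ x n(1)] iX base_in by fastforce
    finally show "\<rho> (\<pi> (i s)) x \<le> K2 * exp (- s) + e" .
  qed
  have K1_0: "K1 \<ge> 0" using K1[of a] by linarith
  have "tracks \<gamma> x"
    unfolding tracks_def \<gamma> fst_conv snd_conv
  proof (intro conjI exI[of _ "K1 + K2"] allI impI)
    show "K1 + K2 > 0" using K1_0 unfolding K2_def by (intro add_nonneg_pos) auto
    fix t assume t: "a \<le> t"
    have "K2 * exp (- t) \<le> (K1 + K2) * exp (- t)" using K1_0 by (intro mult_right_mono) auto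
    then show "\<rho> (\<pi> (i t)) x \<le> (K1 + K2) * exp (- t)" using lim_bound[OF t] by linarith
    have "K2 \<ge> 0" unfolding K2_def by simp
    then show "\<bar>ht (i t) - t\<bar> \<le> K1 + K2" using K1[OF t] by linarith
  qed (use x assms \<gamma> in auto)
  then show ?thesis ..
qed

lemma tracks_pt:
  assumes x: "x \<in> Z"
  shows "tracks (0, pt x) x"
  unfolding tracks_def
proof (intro conjI exI[of _ 1])
  have "qi_embedding_with 1 0 {0..} dist X d (pt x)"
    using x by (intro qi_embedding_1I) (auto simp: pt_in d_pt_same)
  then show "(0, pt x) \<in> rough_rays X d"
    unfolding rough_rays_def rough_ray_def by auto
qed (use x in \<open>auto simp: base_pt ht_pt\<close>)

text \<open>The base points converge and the height term vanishes, so the limit is the same for all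
  representatives; hence the supremum in the boundary product is harmless.\<close>

lemma tracks_tendsto:
  assumes \<gamma>: "tracks \<gamma> x" and \<gamma>': "tracks \<gamma>' y" and e: "e > 0"
  shows "\<forall>\<^sub>F (s, t) in at_top \<times>\<^sub>F at_top. s \<ge> fst \<gamma> \<and> t \<ge> fst \<gamma>' \<and>
    \<bar>\<theta> (snd \<gamma> s) (snd \<gamma>' t) - \<rho> x y\<bar> < e"
proof -
  obtain K where K: "K > 0" "\<And>t. t \<ge> fst \<gamma> \<Longrightarrow> \<rho> (\<pi> (snd \<gamma> t)) x \<le> K * exp (- t)"
      "\<And>t. t \<ge> fst \<gamma> \<Longrightarrow> \<bar>ht (snd \<gamma> t) - t\<bar> \<le> K"
    using \<gamma> unfolding tracks_def by blast
  obtain K' where K': "K' > 0" "\<And>t. t \<ge> fst \<gamma>' \<Longrightarrow> \<rho> (\<pi> (snd \<gamma>' t)) y \<le> K' * exp (- t)"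
      "\<And>t. t \<ge> fst \<gamma>' \<Longrightarrow> \<bar>ht (snd \<gamma>' t) - t\<bar> \<le> K'"
    using \<gamma>' unfolding tracks_def by blast
  have xy: "x \<in> Z" "y \<in> Z" using \<gamma> \<gamma>' unfolding tracks_def by auto
  have Z\<gamma>: "\<pi> (snd \<gamma> s) \<in> Z" if "s \<ge> fst \<gamma>" for s
    using \<gamma> that rough_rays_in[of "fst \<gamma>" "snd \<gamma>"] base_in unfolding tracks_def by auto
  have Z\<gamma>': "\<pi> (snd \<gamma>' s) \<in> Z" if "s \<ge> fst \<gamma>'" for s
    using \<gamma>' that rough_rays_in[of "fst \<gamma>'" "snd \<gamma>'"] base_in unfolding tracks_def by auto
  have bound: "\<bar>\<theta> (snd \<gamma> s) (snd \<gamma>' t) - \<rho> x y\<bar> \<le> (K + exp K) * exp (- s) + (K' + exp K') * exp (- t)"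
    if s: "s \<ge> fst \<gamma>" and t: "t \<ge> fst \<gamma>'" for s t
  proof -
    let ?p = "\<pi> (snd \<gamma> s)" and ?q = "\<pi> (snd \<gamma>' t)"
    have "\<rho> x y \<le> \<rho> x ?p + \<rho> ?p y" "\<rho> ?p y \<le> \<rho> ?p ?q + \<rho> ?q y"
      "\<rho> ?p ?q \<le> \<rho> ?p x + \<rho> x ?q" "\<rho> x ?q \<le> \<rho> x y + \<rho> y ?q"
      using xy Z\<gamma>[OF s] Z\<gamma>'[OF t] by (auto intro: Z.triangle)
    then have "\<bar>\<rho> ?p ?q - \<rho> x y\<bar> \<le> K * exp (- s) + K' * exp (- t)"
      using K(2)[OF s] K'(2)[OF t] Z.commute[of x ?p] Z.commute[of y ?q] by linarith
    moreover have "exp (- ht (snd \<gamma> s)) \<le> exp (K + - s)" "exp (- ht (snd \<gamma>' t)) \<le> exp (K' + - t)"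
      using K(3)[OF s] K'(3)[OF t] by auto
    then have "exp (- min (ht (snd \<gamma> s)) (ht (snd \<gamma>' t))) \<le> exp K * exp (- s) + exp K' * exp (- t)"
      unfolding exp_add by (smt (verit) exp_gt_zero mult_pos_pos)
    ultimately show ?thesis
      unfolding \<theta>_def ring_distribs using exp_gt_zero[of "- min (ht (snd \<gamma> s)) (ht (snd \<gamma>' t))"] by linarith
  qed
  have small: "\<forall>\<^sub>F s in at_top. c * exp (- s) < e / 2" for c :: real
  proof -
    have "((\<lambda>s. c * exp (- s)) \<longlongrightarrow> c * 0) at_top"
      by (intro tendsto_mult tendsto_const filterlim_compose[OF exp_at_bot] filterlim_uminus_at_bot_at_top)
    then show ?thesis using e by (intro order_tendstoD(2)) auto
  qed
  have "\<forall>\<^sub>F s in at_top. s \<ge> fst \<gamma> \<and> (K + exp K) * exp (- s) < e / 2"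
    by (intro eventually_conj eventually_ge_at_top small)
  moreover have "\<forall>\<^sub>F t in at_top. t \<ge> fst \<gamma>' \<and> (K' + exp K') * exp (- t) < e / 2"
    by (intro eventually_conj eventually_ge_at_top small)
  ultimately have "\<forall>\<^sub>F z in at_top \<times>\<^sub>F at_top. (fst z \<ge> fst \<gamma> \<and> (K + exp K) * exp (- fst z) < e / 2) \<and>
      (snd z \<ge> fst \<gamma>' \<and> (K' + exp K') * exp (- snd z) < e / 2)"
    by (rule eventually_prodI)
  then show ?thesis
  proof (rule eventually_mono, clarify, goal_cases)
    case (1 s t)
    then show ?case using bound[of s t] by simp
  qed
qed

text \<open>With a common endpoint, points whose parameters differ by at most the shift between the
  two starting times are at bounded distance. Conversely, rays at bounded distance have comparable
  heights at nearby points, which forces \<open>\<rho> x y\<close> below a fixed multiple of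
  \<open>exp (- t)\<close> for all \<open>t \<ge> a\<close>.\<close>

lemma tracks_equiv_iff:
  assumes \<gamma>: "tracks \<gamma> x" and \<gamma>': "tracks \<gamma>' y"
  shows "(\<gamma>, \<gamma>') \<in> ray_equiv X d \<longleftrightarrow> x = y"
proof -
  obtain a i b j where eq: "\<gamma> = (a, i)" "\<gamma>' = (b, j)" by (metis surj_pair)
  have xy: "x \<in> Z" "y \<in> Z" and rays: "(a, i) \<in> rough_rays X d" "(b, j) \<in> rough_rays X d"
    using \<gamma> \<gamma>' unfolding tracks_def eq by auto
  obtain K where K: "K > 0" "\<And>t. t \<ge> a \<Longrightarrow> \<rho> (\<pi> (i t)) x \<le> K * exp (- t)"
      "\<And>t. t \<ge> a \<Longrightarrow> \<bar>ht (i t) - t\<bar> \<le> K"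
    using \<gamma> unfolding tracks_def eq by auto
  obtain K' where K': "K' > 0" "\<And>t. t \<ge> b \<Longrightarrow> \<rho> (\<pi> (j t)) y \<le> K' * exp (- t)"
      "\<And>t. t \<ge> b \<Longrightarrow> \<bar>ht (j t) - t\<bar> \<le> K'"
    using \<gamma>' unfolding tracks_def eq by auto
  have Zi: "\<pi> (i s) \<in> Z" if "s \<ge> a" for s using rough_rays_in[OF rays(1) that] base_in by auto
  have Zj: "\<pi> (j s) \<in> Z" if "s \<ge> b" for s using rough_rays_in[OF rays(2) that] base_in by auto
  define R where "R = \<bar>b - a\<bar> + K + K' + 2 * ln (K + K' + exp (K + K'))"
  have near: "d (i t) (j t') \<le> R"
    if "x = y" and t: "t \<ge> a" "t' \<ge> b" and tt': "\<bar>t - t'\<bar> \<le> \<bar>b - a\<bar>" for t t'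
  proof -
    let ?m = "min t t'"
    have "\<rho> (\<pi> (i t)) (\<pi> (j t')) \<le> \<rho> (\<pi> (i t)) x + \<rho> x (\<pi> (j t'))"
      using xy Zi Zj t by (intro Z.triangle) auto
    also have "\<dots> \<le> K * exp (- t) + K' * exp (- t')"
      using K(2)[OF t(1)] K'(2)[OF t(2)] \<open>x = y\<close> Z.commute by (intro add_mono) auto
    also have "\<dots> \<le> K * exp (- ?m) + K' * exp (- ?m)"
      using K K' by (intro add_mono mult_left_mono) auto
    finally have "\<rho> (\<pi> (i t)) (\<pi> (j t')) \<le> (K + K') * exp (- ?m)" by (simp add: algebra_simps)
    moreover have "exp (- min (ht (i t)) (ht (j t'))) \<le> exp (K + K' + - ?m)"
      using K(1) K'(1) K(3)[OF t(1)] K'(3)[OF t(2)] by (simp only: exp_le_cancel_iff)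
    ultimately have "\<theta> (i t) (j t') \<le> (K + K' + exp (K + K')) * exp (- ?m)"
      unfolding \<theta>_def exp_add[of "K + K'"] by (simp add: algebra_simps)
    then have "d (i t) (j t') \<le> ht (i t) + ht (j t') + 2 * ln ((K + K' + exp (K + K')) * exp (- ?m))"
      by (rule d_le)
    also have "ln ((K + K' + exp (K + K')) * exp (- ?m)) = ln (K + K' + exp (K + K')) - ?m"
      using add_pos_pos[OF add_pos_pos[OF K(1) K'(1)] exp_gt_zero[of "K + K'"]] by (simp add: ln_mult)
    finally show ?thesis unfolding R_def
      using K(3)[OF t(1)] K'(3)[OF t(2)] tt' by (smt (verit))
  qed
  show ?thesis
  proof
    assume "x = y"
    have "in_nbhd d R (i ` {a..}) (j ` {b..})"
      unfolding in_nbhd_def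
    proof (rule ballI)
      fix p assume "p \<in> i ` {a..}"
      then obtain t where "t \<ge> a" "p = i t" by auto
      then show "\<exists>q\<in>j ` {b..}. d p q \<le> R"
        by (intro bexI[of _ "j (max t b)"]) (auto intro: near[OF \<open>x = y\<close>])
    qed
    moreover have "in_nbhd d R (j ` {b..}) (i ` {a..})"
      unfolding in_nbhd_def
    proof (rule ballI)
      fix q assume "q \<in> j ` {b..}"
      then obtain t where "t \<ge> b" "q = j t" by auto
      then show "\<exists>p\<in>i ` {a..}. d q p \<le> R"
        by (intro bexI[of _ "i (max t a)"]) (auto simp: d_commute[of "j t"] intro!: near[OF \<open>x = y\<close>])
    qed
    moreover have "R \<ge> 0"
      using near[OF \<open>x = y\<close>, of "max a b" "max a b"] d_nonneg[of "i (max a b)" "j (max a b)"] by simp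
    ultimately show "(\<gamma>, \<gamma>') \<in> ray_equiv X d" unfolding ray_equiv_def eq using rays by auto
  next
    assume "(\<gamma>, \<gamma>') \<in> ray_equiv X d"
    then obtain D where "\<forall>p\<in>i ` {a..}. \<exists>q\<in>j ` {b..}. d p q \<le> D"
      unfolding ray_equiv_def eq in_nbhd_def by blast
    then have D: "\<exists>t'\<ge>b. d (i t) (j t') \<le> D" if "t \<ge> a" for t using that by auto
    have "\<rho> x y \<le> (K + exp (D + K) + K' * exp (D + K + K')) * exp (- t)" if t: "t \<ge> a" for t
    proof -
      obtain t' where t': "t' \<ge> b" "d (i t) (j t') \<le> D" using D[OF t] by blast
      have ht: "\<bar>ht (i t) - ht (j t')\<bar> \<le> D" using abs_ht_le_d t' order_trans by blast
      have "\<rho> x y \<le> \<rho> x (\<pi> (i t)) + \<rho> (\<pi> (i t)) y"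
        "\<rho> (\<pi> (i t)) y \<le> \<rho> (\<pi> (i t)) (\<pi> (j t')) + \<rho> (\<pi> (j t')) y"
        using xy Zi[OF t] Zj[OF t'(1)] by (auto intro: Z.triangle)
      moreover have "\<rho> (\<pi> (i t)) (\<pi> (j t')) \<le> exp ((D + K) + - t)"
      proof -
        have "\<rho> (\<pi> (i t)) (\<pi> (j t')) \<le> \<theta> (i t) (j t')" unfolding \<theta>_def by simp
        also have "\<dots> \<le> exp ((D - ht (i t) - ht (j t')) / 2)" by (rule \<theta>_le_exp[OF t'(2)])
        also have "\<dots> \<le> exp ((D + K) + - t)" using ht K(3)[OF t] by (simp only: exp_le_cancel_iff) argo
        finally show ?thesis .
      qed
      moreover have "K' * exp (- t') \<le> K' * exp ((D + K + K') + - t)"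
      proof -
        have "- t' \<le> (D + K + K') + - t" using ht K(3)[OF t] K'(3)[OF t'(1)] by linarith
        then have "exp (- t') \<le> exp ((D + K + K') + - t)" by (simp only: exp_le_cancel_iff)
        then show ?thesis using K'(1) by (intro mult_left_mono) auto
      qed
      ultimately show ?thesis
        unfolding exp_add ring_distribs
        using K(2)[OF t] K'(2)[OF t'(1)] Z.commute[of x "\<pi> (i t)"] by (simp add: mult.assoc)
    qed
    then have "\<forall>\<^sub>F t in at_top. \<rho> x y \<le> (K + exp (D + K) + K' * exp (D + K + K')) * exp (- t)"
      unfolding eventually_at_top_linorder by blast
    moreover have "((\<lambda>t. (K + exp (D + K) + K' * exp (D + K + K')) * exp (- t)) \<longlongrightarrow>
        (K + exp (D + K) + K' * exp (D + K + K')) * 0) at_top"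
      by (intro tendsto_mult tendsto_const filterlim_compose[OF exp_at_bot] filterlim_uminus_at_bot_at_top)
    ultimately have "\<rho> x y \<le> (K + exp (D + K) + K' * exp (D + K + K')) * 0"
      by (intro tendsto_lowerbound) auto
    then have "\<rho> x y \<le> 0" by simp
    then show "x = y" using Z.nonneg[of x y] Z.zero[OF xy] by linarith
  qed
qed

lemma boundary_eq: "boundary X d = boundary_class ` Z"
proof -
  have cls: "ray_equiv X d `` {\<gamma>} = boundary_class x" if "tracks \<gamma> x" for \<gamma> x
  proof -
    have "\<gamma>' \<in> rough_rays X d" if "(\<gamma>, \<gamma>') \<in> ray_equiv X d" for \<gamma>'
      using that unfolding ray_equiv_def by auto
    then show ?thesis
      unfolding boundary_class_def
      using tracks_equiv_iff[OF that] rough_ray_tracks that by blast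
  qed
  have tr: "\<gamma> \<in> rough_rays X d" "x \<in> Z" if "tracks \<gamma> x" for \<gamma> x
    using that unfolding tracks_def by auto
  show ?thesis
  proof (intro equalityI subsetI)
    fix \<xi> assume "\<xi> \<in> boundary X d"
    then obtain \<gamma> where \<gamma>: "\<gamma> \<in> rough_rays X d" "\<xi> = ray_equiv X d `` {\<gamma>}"
      unfolding boundary_def by (rule quotientE)
    obtain x where x: "tracks \<gamma> x" using rough_ray_tracks[OF \<gamma>(1)] ..
    show "\<xi> \<in> boundary_class ` Z" unfolding \<gamma>(2) cls[OF x] using tr(2)[OF x] by (rule imageI)
  next
    fix \<xi> assume "\<xi> \<in> boundary_class ` Z"
    then obtain x where x: "x \<in> Z" "\<xi> = boundary_class x" by blast
    show "\<xi> \<in> boundary X d"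
      unfolding boundary_def x(2) cls[OF tracks_pt[OF x(1)], symmetric]
      by (rule quotientI, rule tr(1), rule tracks_pt[OF x(1)])
  qed
qed

lemma inj_boundary_class: "inj_on boundary_class Z"
proof
  fix x y assume xy: "x \<in> Z" "y \<in> Z" "boundary_class x = boundary_class y"
  then have "tracks (0, pt x) x" "tracks (0, pt x) y"
    using tracks_pt unfolding boundary_class_def by auto
  then show "x = y"
    using tracks_equiv_iff[of "(0, pt x)" x "(0, pt x)" x] tracks_equiv_iff[of "(0, pt x)" x "(0, pt x)" y]
    by simp
qed

section \<open>Gromov products at infinity and visual metrics\<close>

lemma Gromov_product_bound:
  assumes w: "w \<in> X" and p: "p \<in> X" and q: "q \<in> X"
  shows "\<bar>Gromov_product d w p q + ln (\<theta> p q)\<bar> \<le> ht w + 2 * ln (B + 1)"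
proof -
  have "- ht w \<le> ln (\<theta> p w) \<and> ln (\<theta> p w) \<le> ln (B + 1)" if p: "p \<in> X" for p
  proof
    have "ln (exp (- ht w)) \<le> ln (\<theta> p w)" using \<theta>_ge(2) by (subst ln_le_cancel_iff) auto
    then show "- ht w \<le> ln (\<theta> p w)" by simp
    show "ln (\<theta> p w) \<le> ln (B + 1)"
      using \<theta>_le[OF p w] B_nonneg by (subst ln_le_cancel_iff) auto
  qed
  from this[OF p] this[OF q]
  have "- ht w \<le> ln (\<theta> p w)" "ln (\<theta> p w) \<le> ln (B + 1)" "- ht w \<le> ln (\<theta> q w)" "ln (\<theta> q w) \<le> ln (B + 1)"
    by auto
  moreover have "ln (B + 1) \<ge> 0" using B_nonneg by simp
  ultimately show ?thesis unfolding Gromov_product_eq by linarith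
qed

lemma boundary_Gromov_product_same:
  assumes x: "x \<in> Z" and w: "w \<in> X"
  shows "boundary_Gromov_product d w (boundary_class x) (boundary_class x) = \<infinity>"
proof -
  let ?\<gamma> = "(0, pt x)" and ?c = "ht w + 2 * ln (B + 1)"
  have "Liminf (at_top \<times>\<^sub>F at_top) (\<lambda>(s, t). ereal (Gromov_product d w (pt x s) (pt x t))) \<ge> ereal r" for r
  proof (rule Liminf_bounded)
    have "\<forall>\<^sub>F (s, t) in at_top \<times>\<^sub>F at_top. s \<ge> 0 \<and> t \<ge> 0 \<and>
        \<bar>\<theta> (pt x s) (pt x t) - \<rho> x x\<bar> < exp (- r - ?c)"
      using tracks_tendsto[OF tracks_pt[OF x] tracks_pt[OF x], of "exp (- r - ?c)"] by simp
    then show "\<forall>\<^sub>F z in at_top \<times>\<^sub>F at_top. ereal r \<le>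
        (case z of (s, t) \<Rightarrow> ereal (Gromov_product d w (pt x s) (pt x t)))"
    proof (rule eventually_mono, clarify, goal_cases)
      case (1 s t)
      have "\<theta> (pt x s) (pt x t) \<le> exp (- r - ?c)" using 1 x by simp
      then have "ln (\<theta> (pt x s) (pt x t)) \<le> - r - ?c" by (metis \<theta>_pos exp_ln exp_le_cancel_iff)
      then show ?case using Gromov_product_bound[OF w, of "pt x s" "pt x t"] 1 x pt_in by fastforce
    qed
  qed
  also have "\<dots> \<le> boundary_Gromov_product d w (boundary_class x) (boundary_class x)"
    unfolding boundary_Gromov_product_def
    by (rule SUP_upper2[of "(?\<gamma>, ?\<gamma>)"]) (use x tracks_pt in \<open>auto simp: boundary_class_def\<close>)
  finally have "ereal r \<le> boundary_Gromov_product d w (boundary_class x) (boundary_class x)" for r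
    by simp
  then show ?thesis by (simp add: ereal_top)
qed

text \<open>The lower bound needs one pair of representatives, the vertical rays; the upper bound
  treats all pairs. The term \<open>ln 2\<close> allows \<open>\<theta>\<close> to differ from its
  limit \<open>\<rho> x y\<close> by a factor 2.\<close>

lemma boundary_Gromov_product_bounds:
  assumes xy: "x \<in> Z" "y \<in> Z" "x \<noteq> y" and w: "w \<in> X"
  shows "ereal (- ln (\<rho> x y) - (ht w + 2 * ln (B + 1) + ln 2)) \<le> boundary_Gromov_product d w (boundary_class x) (boundary_class y)"
    and "boundary_Gromov_product d w (boundary_class x) (boundary_class y)
      \<le> ereal (- ln (\<rho> x y) + (ht w + 2 * ln (B + 1) + ln 2))"
proof -
  define c where "c = ht w + 2 * ln (B + 1) + ln 2"
  let ?F = "at_top \<times>\<^sub>F at_top :: (real \<times> real) filter"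
  have \<rho>: "\<rho> x y > 0" using xy by (simp add: Z.mdist_pos_less)
  have ev: "\<forall>\<^sub>F z in ?F. ereal (- ln (\<rho> x y) - c) \<le>
        (case z of (s, t) \<Rightarrow> ereal (Gromov_product d w (snd \<gamma> s) (snd \<gamma>' t))) \<and>
        (case z of (s, t) \<Rightarrow> ereal (Gromov_product d w (snd \<gamma> s) (snd \<gamma>' t))) \<le> ereal (- ln (\<rho> x y) + c)"
    if \<gamma>: "tracks \<gamma> x" "tracks \<gamma>' y" for \<gamma> \<gamma>'
  proof -
    have "\<forall>\<^sub>F (s, t) in ?F. s \<ge> fst \<gamma> \<and> t \<ge> fst \<gamma>' \<and> \<bar>\<theta> (snd \<gamma> s) (snd \<gamma>' t) - \<rho> x y\<bar> < \<rho> x y / 2"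
      using tracks_tendsto[OF \<gamma>, of "\<rho> x y / 2"] \<rho> by simp
    then show ?thesis
    proof (rule eventually_mono, clarify, goal_cases)
      case (1 s t)
      let ?p = "snd \<gamma> s" and ?q = "snd \<gamma>' t"
      have "\<rho> x y / 2 \<le> \<theta> ?p ?q" "\<theta> ?p ?q \<le> \<rho> x y * 2" using 1 \<rho> by linarith+
      then have "ln (\<rho> x y / 2) \<le> ln (\<theta> ?p ?q)" "ln (\<theta> ?p ?q) \<le> ln (\<rho> x y * 2)"
        using \<rho> by (simp_all del: ln_mult ln_div)
      then have "ln (\<rho> x y) - ln 2 \<le> ln (\<theta> ?p ?q)" "ln (\<theta> ?p ?q) \<le> ln (\<rho> x y) + ln 2"
        using \<rho> by (simp_all add: ln_div ln_mult)
      moreover have "?p \<in> X" "?q \<in> X"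
        using \<gamma> 1 rough_rays_in[of "fst \<gamma>" "snd \<gamma>"] rough_rays_in[of "fst \<gamma>'" "snd \<gamma>'"]
        unfolding tracks_def by auto
      ultimately show ?case
        using Gromov_product_bound[OF w, of ?p ?q] unfolding c_def by auto
    qed
  qed
  have F: "?F \<noteq> bot" by (simp add: prod_filter_eq_bot)
  have "ereal (- ln (\<rho> x y) - c) \<le>
      Liminf ?F (\<lambda>(s, t). ereal (Gromov_product d w (snd (0::real, pt x) s) (snd (0::real, pt y) t)))"
    by (rule Liminf_bounded, rule eventually_mono[OF ev[OF tracks_pt tracks_pt]]) (use xy in auto)
  also have "\<dots> \<le> boundary_Gromov_product d w (boundary_class x) (boundary_class y)"
    unfolding boundary_Gromov_product_def
    by (rule SUP_upper2[of "((0, pt x), (0, pt y))"]) (use xy tracks_pt in \<open>auto simp: boundary_class_def\<close>)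
  finally show "ereal (- ln (\<rho> x y) - (ht w + 2 * ln (B + 1) + ln 2)) \<le> boundary_Gromov_product d w (boundary_class x) (boundary_class y)" unfolding c_def .
  show "boundary_Gromov_product d w (boundary_class x) (boundary_class y)
      \<le> ereal (- ln (\<rho> x y) + (ht w + 2 * ln (B + 1) + ln 2))"
    unfolding boundary_Gromov_product_def c_def[symmetric]
  proof (rule SUP_least, clarify)
    fix a i b j assume "(a, i) \<in> boundary_class x" "(b, j) \<in> boundary_class y"
    then have "tracks (a, i) x" "tracks (b, j) y" unfolding boundary_class_def by auto
    from eventually_mono[OF ev[OF this]]
    have "Limsup ?F (\<lambda>(s, t). ereal (Gromov_product d w (snd (a, i) s) (snd (b, j) t))) \<le> ereal (- ln (\<rho> x y) + c)"
      by (intro Limsup_bounded) (smt (verit))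
    with Liminf_le_Limsup[OF F]
    show "Liminf ?F (\<lambda>(s, t). ereal (Gromov_product d w (snd (a, i) s) (snd (b, j) t))) \<le> ereal (- ln (\<rho> x y) + c)"
      by (rule order_trans)
  qed
qed

lemma exp_minus_bounds:
  assumes w: "w \<in> X" and \<epsilon>: "\<epsilon> > 0"
  shows "\<exists>K\<ge>1. \<forall>x\<in>Z. \<forall>y\<in>Z.
    1 / K * \<rho> x y powr \<epsilon> \<le> exp_minus \<epsilon> (boundary_Gromov_product d w (boundary_class x) (boundary_class y)) \<and>
    exp_minus \<epsilon> (boundary_Gromov_product d w (boundary_class x) (boundary_class y)) \<le> K * \<rho> x y powr \<epsilon>"
proof -
  define c where "c = ht w + 2 * ln (B + 1) + ln 2"
  have "c \<ge> 0" unfolding c_def using ht_nonneg[OF w] B_nonneg by simp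
  have "1 / exp (\<epsilon> * c) * \<rho> x y powr \<epsilon> \<le> exp_minus \<epsilon> (boundary_Gromov_product d w (boundary_class x) (boundary_class y)) \<and>
    exp_minus \<epsilon> (boundary_Gromov_product d w (boundary_class x) (boundary_class y)) \<le> exp (\<epsilon> * c) * \<rho> x y powr \<epsilon>"
    if xy: "x \<in> Z" "y \<in> Z" for x y
  proof (cases "x = y")
    case True
    \<comment> \<open>All terms are 0: the product is infinite, \<open>exp_minus\<close> is 0 there,
      and \<open>0 powr \<epsilon> = 0\<close>.\<close>
    then show ?thesis
      using boundary_Gromov_product_same[OF xy(1) w] xy by (simp add: exp_minus_def)
  next
    case False
    then have \<rho>: "\<rho> x y > 0" using xy by (simp add: Z.mdist_pos_less)
    obtain r where r: "boundary_Gromov_product d w (boundary_class x) (boundary_class y) = ereal r"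
      "- ln (\<rho> x y) - c \<le> r" "r \<le> - ln (\<rho> x y) + c"
      using boundary_Gromov_product_bounds[OF xy False w] unfolding c_def
      by (cases "boundary_Gromov_product d w (boundary_class x) (boundary_class y)") auto
    have "- (\<epsilon> * c) + \<epsilon> * ln (\<rho> x y) \<le> - \<epsilon> * r" "- \<epsilon> * r \<le> \<epsilon> * c + \<epsilon> * ln (\<rho> x y)"
      using mult_left_mono[OF r(2), of \<epsilon>] mult_left_mono[OF r(3), of \<epsilon>] \<epsilon> by (simp_all add: algebra_simps)
    then have "exp (- (\<epsilon> * c) + \<epsilon> * ln (\<rho> x y)) \<le> exp (- \<epsilon> * r)" "exp (- \<epsilon> * r) \<le> exp (\<epsilon> * c + \<epsilon> * ln (\<rho> x y))"
      by (simp_all only: exp_le_cancel_iff)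
    then show ?thesis
      unfolding r(1) exp_minus_def exp_add using \<rho> by (simp add: powr_def exp_minus inverse_eq_divide)
  qed
  moreover have "exp (\<epsilon> * c) \<ge> 1" using \<epsilon> \<open>c \<ge> 0\<close> by simp
  ultimately show ?thesis by blast
qed

text \<open>The exponent 1 works because \<open>\<rho>\<close> is already a metric and comparable to
  the exponential of minus the boundary product.\<close>

lemma visual_metric_exists: "\<exists>\<rho>'. visual_metric X d \<rho>'"
proof -
  define g where "g = inv_into Z boundary_class"
  have g: "g (boundary_class x) = x" if "x \<in> Z" for x
    unfolding g_def using that inj_boundary_class by simp
  obtain x0 where "x0 \<in> Z" using nonempty by blast
  then have w: "pt x0 0 \<in> X" by (simp add: pt_in)
  obtain K where "K \<ge> 1" "\<And>x y. x \<in> Z \<Longrightarrow> y \<in> Z \<Longrightarrow>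
    1 / K * \<rho> x y powr 1 \<le> exp_minus 1 (boundary_Gromov_product d (pt x0 0) (boundary_class x) (boundary_class y)) \<and>
    exp_minus 1 (boundary_Gromov_product d (pt x0 0) (boundary_class x) (boundary_class y)) \<le> K * \<rho> x y powr 1"
    using exp_minus_bounds[OF w, of 1] by auto
  note K = this
  have "visual_metric X d (\<lambda>\<xi> \<eta>. \<rho> (g \<xi>) (g \<eta>))"
    unfolding visual_metric_def
  proof (rule conjI, goal_cases)
    case 2
    show ?case
    proof (rule bexI[OF _ w], rule exI[of _ 1], rule conjI[OF zero_less_one],
        rule exI[of _ K], rule conjI[OF K(1)], intro ballI)
      fix \<xi> \<eta> assume "\<xi> \<in> boundary X d" "\<eta> \<in> boundary X d"
      then obtain x y where xy: "x \<in> Z" "y \<in> Z" "\<xi> = boundary_class x" "\<eta> = boundary_class y"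
        unfolding boundary_eq by blast
      show "1 / K * exp_minus 1 (boundary_Gromov_product d (pt x0 0) \<xi> \<eta>) \<le> \<rho> (g \<xi>) (g \<eta>) \<and>
        \<rho> (g \<xi>) (g \<eta>) \<le> K * exp_minus 1 (boundary_Gromov_product d (pt x0 0) \<xi> \<eta>)"
        using K(2)[OF xy(1,2)] K(1) unfolding xy(3,4) by (simp add: g xy field_simps)
    qed
  next
    case 1
    show "Metric_space (boundary X d) (\<lambda>\<xi> \<eta>. \<rho> (g \<xi>) (g \<eta>))"
      by standard (auto simp: boundary_eq g Z.commute intro: Z.triangle)
  qed
  then show ?thesis by blast
qed

text \<open>By \<open>upper\<close>, small \<open>\<rho>\<close> gives small \<open>\<rho>'\<close>,
  so \<open>boundary_class\<close> is continuous; a continuous bijection from a compact space to a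
  Hausdorff space is a homeomorphism.\<close>

lemma visual_metric_homeomorphic:
  assumes "visual_metric X d \<rho>'"
  shows "top_of_set Z homeomorphic_space Metric_space.mtopology (boundary X d) \<rho>'"
proof -
  interpret D: Metric_space "boundary X d" \<rho>' using assms unfolding visual_metric_def by blast
  obtain w \<epsilon> K1 where w: "w \<in> X" and \<epsilon>: "\<epsilon> > 0" and K1: "K1 \<ge> 1"
    "\<And>\<xi> \<eta>. \<xi> \<in> boundary X d \<Longrightarrow> \<eta> \<in> boundary X d \<Longrightarrow>
      \<rho>' \<xi> \<eta> \<le> K1 * exp_minus \<epsilon> (boundary_Gromov_product d w \<xi> \<eta>)"
    using assms unfolding visual_metric_def by blast
  obtain K2 where K2: "K2 \<ge> 1" "\<And>x y. x \<in> Z \<Longrightarrow> y \<in> Z \<Longrightarrow>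
      exp_minus \<epsilon> (boundary_Gromov_product d w (boundary_class x) (boundary_class y)) \<le> K2 * \<rho> x y powr \<epsilon>"
    using exp_minus_bounds[OF w \<epsilon>] by blast
  have upper: "\<rho>' (boundary_class x) (boundary_class y) \<le> K1 * K2 * \<rho> x y powr \<epsilon>"
    if "x \<in> Z" "y \<in> Z" for x y
  proof -
    have "\<rho>' (boundary_class x) (boundary_class y)
        \<le> K1 * exp_minus \<epsilon> (boundary_Gromov_product d w (boundary_class x) (boundary_class y))"
      using that by (intro K1(2)) (auto simp: boundary_eq)
    also have "\<dots> \<le> K1 * (K2 * \<rho> x y powr \<epsilon>)" using K1(1) K2(2)[OF that] by (intro mult_left_mono) auto
    finally show ?thesis by (simp add: mult.assoc)
  qed
  have "homeomorphic_map (top_of_set Z) D.mtopology boundary_class"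
  proof (rule continuous_imp_homeomorphic_map)
    show "compact_space (top_of_set Z)" using compact by (simp add: compact_space_subtopology compactin_euclidean_iff)
    show "Hausdorff_space D.mtopology" by (rule D.Hausdorff_space_mtopology)
    show "boundary_class ` topspace (top_of_set Z) = topspace D.mtopology"
      unfolding D.topspace_mtopology by (simp add: boundary_eq)
    show "inj_on boundary_class (topspace (top_of_set Z))" using inj_boundary_class by simp
    show "continuous_map (top_of_set Z) D.mtopology boundary_class"
      unfolding D.continuous_map_to_metric
    proof (intro ballI allI impI)
      fix x e assume x: "x \<in> topspace (top_of_set Z)" and e: "(e::real) > 0"
      define e' where "e' = (e / (K1 * K2)) powr (1 / \<epsilon>)"
      have KK: "K1 * K2 > 0" using K1 K2 by simp
      have e': "e' > 0" unfolding e'_def using divide_pos_pos[OF e KK] by (subst powr_gt_zero) (rule less_imp_neq[symmetric])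
      obtain \<delta> where \<delta>: "\<delta> > 0" "\<And>y. y \<in> Z \<Longrightarrow> dist x y < \<delta> \<Longrightarrow> \<rho> x y < e'"
        using fine[OF e'] x by auto
      have "boundary_class y \<in> D.mball (boundary_class x) e" if y: "y \<in> Z" "dist x y < \<delta>" for y
      proof -
        have "\<rho> x y powr \<epsilon> < e' powr \<epsilon>" using \<delta>(2)[OF y] \<epsilon> by (intro powr_less_mono2) auto
        also have "e' powr \<epsilon> = e / (K1 * K2)" proof -
          have "e' powr \<epsilon> = (e / (K1 * K2)) powr 1" unfolding e'_def powr_powr using \<epsilon> by simp
          then show ?thesis using powr_one[OF less_imp_le[OF divide_pos_pos[OF e KK]]] by simp
        qed
        finally have "K1 * K2 * \<rho> x y powr \<epsilon> < e"
          unfolding pos_less_divide_eq[OF KK] by (simp only: mult.commute)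
        then have "\<rho>' (boundary_class x) (boundary_class y) < e" using upper[of x y] x y by simp
        then show ?thesis using x y unfolding D.in_mball by (simp add: boundary_eq)
      qed
      then show "\<exists>U. openin (top_of_set Z) U \<and> x \<in> U \<and> (\<forall>y\<in>U. boundary_class y \<in> D.mball (boundary_class x) e)"
        using x \<delta>(1) by (intro exI[of _ "Z \<inter> ball x \<delta>"]) (auto simp: openin_open)
    qed
  qed
  then show ?thesis by (rule homeomorphic_map_imp_homeomorphic_space)
qed

lemma boundary_is_Sierpinski_carpet_cone:
  assumes "Sierpinski_carpet (top_of_set Z)"
  shows "boundary_is_Sierpinski_carpet X d"
  unfolding boundary_is_Sierpinski_carpet_def
proof (intro conjI allI impI visual_metric_exists)
  fix \<rho>' assume "visual_metric X d \<rho>'"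
  from visual_metric_homeomorphic[OF this] assms
  show "Sierpinski_carpet (Metric_space.mtopology (boundary X d) \<rho>')"
    unfolding Sierpinski_carpet_def
    using homeomorphic_compact_space homeomorphic_space_sym homeomorphic_space_trans by blast
qed

subsection \<open>Quasi-isometric embeddings of the cone\<close>

text \<open>Level 0 has diameter at most \<open>2 * ln (B + 1)\<close>.\<close>

lemma ht_image_level_0_bounded:
  assumes f: "qi_embedding_with l C X d X d f"
  shows "\<exists>c. \<forall>x\<in>Z. ht (f (pt x 0)) \<le> c"
proof -
  obtain x0 where x0: "x0 \<in> Z" using nonempty by blast
  have "ht (f (pt x 0)) \<le> ht (f (pt x0 0)) + l * (2 * ln (B + 1)) + C" if x: "x \<in> Z" for x
  proof -
    have X: "pt x 0 \<in> X" "pt x0 0 \<in> X" using x x0 by (simp_all add: pt_in)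
    have "d (pt x 0) (pt x0 0) \<le> 2 * ln (B + 1)"
      using d_le[OF \<theta>_le[OF X]] x x0 by (simp add: ht_pt)
    then have "l * d (pt x 0) (pt x0 0) \<le> l * (2 * ln (B + 1))"
      using f unfolding qi_embedding_with_def by (intro mult_left_mono) auto
    moreover have "d (f (pt x 0)) (f (pt x0 0)) \<le> l * d (pt x 0) (pt x0 0) + C"
      using f X unfolding qi_embedding_with_def by blast
    ultimately show ?thesis using abs_ht_le_d[of "f (pt x 0)" "f (pt x0 0)"] by linarith
  qed
  then show ?thesis by blast
qed

text \<open>By stability of quasi-geodesics, a quasi-isometric embedding that almost fixes a sequence of
  points accumulating at every boundary point is coarsely surjective: the image of the vertical ray
  towards such a point of the sequence passes close to every given point of its own ray.\<close>

lemma qi_co_HopfianI: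
  fixes z :: "nat \<Rightarrow> 'a" and D :: "nat \<Rightarrow> nat"
  assumes z: "\<And>n. z n \<in> Z" and D: "\<And>n. D n > 0"
    and dense: "\<And>x e m. x \<in> Z \<Longrightarrow> e > 0 \<Longrightarrow> \<exists>n\<ge>m. \<rho> (z n) x < e"
    and fixed: "\<And>f e. qi_embedding X d X d f \<Longrightarrow> e > 0 \<Longrightarrow>
      \<forall>\<^sub>F n in sequentially. \<rho> (\<pi> (f (pt (z n) (D n)))) (z n) < e \<and> exp (- ht (f (pt (z n) (D n)))) < e"
  shows "qi_co_Hopfian X d"
  unfolding qi_co_Hopfian_def
proof (intro allI impI)
  fix f assume f: "qi_embedding X d X d f"
  then obtain l C where qi: "qi_embedding_with l C X d X d f" unfolding qi_embedding_def by blast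
  then have l: "l \<ge> 1" and fX: "\<And>p. p \<in> X \<Longrightarrow> f p \<in> X"
    and lower: "\<And>p q. p \<in> X \<Longrightarrow> q \<in> X \<Longrightarrow> 1 / l * d p q - C \<le> d (f p) (f q)"
    and upper: "\<And>p q. p \<in> X \<Longrightarrow> q \<in> X \<Longrightarrow> d (f p) (f q) \<le> l * d p q + C"
    unfolding qi_embedding_with_def by auto
  obtain c where c: "\<And>x. x \<in> Z \<Longrightarrow> ht (f (pt x 0)) \<le> c"
    using ht_image_level_0_bounded[OF qi] by blast
  \<comment> \<open>The constant comes from expanding the product at \<open>v\<close> of the
    endpoints of the image chain: \<open>c\<close> bounds
    \<open>- ln (\<theta> (a 0) (a N))\<close>, \<open>ln (B + 1)\<close> bounds
    \<open>ln (\<theta> (a 0) v)\<close>, and \<open>ln 3\<close> bounds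
    \<open>ht v + ln (\<theta> (a N) v)\<close>.\<close>
  obtain H where H: "\<And>a N v. N > 0 \<Longrightarrow> v \<in> X \<Longrightarrow> (\<forall>i\<le>N. a i \<in> X) \<Longrightarrow>
      (\<forall>i\<le>N. \<forall>j\<le>N. \<bar>real i - real j\<bar> / l - C \<le> d (a i) (a j)) \<Longrightarrow>
      (\<forall>i<N. d (a i) (a (Suc i)) \<le> l + C) \<Longrightarrow>
      Gromov_product d v (a 0) (a N) \<le> c + ln (B + 1) + ln 3 \<Longrightarrow> (\<exists>i\<le>N. d v (a i) \<le> H)"
    using quasi_geodesic_near[OF l, of C "l + C" "c + ln (B + 1) + ln 3"] by metis
  have "\<exists>p\<in>X. d v (f p) \<le> max H 0" if v: "v \<in> X" for v
  proof -
    \<comment> \<open>At the scale of \<open>v\<close>, three errors of size \<open>e\<close> add up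
      to \<open>\<theta> \<le> 3 * e\<close>, whose logarithm cancels \<open>ht v\<close>.\<close>
    define x e where "x = \<pi> v" and "e = exp (- ht v)"
    have x: "x \<in> Z" and e: "e > 0" unfolding x_def e_def using v base_in by auto
    obtain n where n: "\<rho> (z n) x < e" "\<rho> (\<pi> (f (pt (z n) (D n)))) (z n) < e"
      "exp (- ht (f (pt (z n) (D n)))) < e"
      using fixed[OF f e] dense[OF x e] unfolding eventually_sequentially by blast
    define a where "a k = f (pt (z n) (real k))" for k :: nat
    have pX: "pt (z n) (real k) \<in> X" for k using z by (simp add: pt_in)
    have aX: "a k \<in> X" for k unfolding a_def by (intro fX pX)
    have d: "d (pt (z n) (real i)) (pt (z n) (real j)) = \<bar>real i - real j\<bar>" for i j
      using z by (simp add: d_pt_same)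
    have "\<exists>i\<le>D n. d v (a i) \<le> H"
    proof (rule H)
      show "D n > 0" "v \<in> X" "\<forall>i\<le>D n. a i \<in> X" using D v aX by auto
      show "\<forall>i\<le>D n. \<forall>j\<le>D n. \<bar>real i - real j\<bar> / l - C \<le> d (a i) (a j)"
        using lower[OF pX pX] unfolding a_def d by auto
      show "\<forall>i<D n. d (a i) (a (Suc i)) \<le> l + C"
      proof (intro allI impI)
        fix i show "d (a i) (a (Suc i)) \<le> l + C"
          using upper[OF pX pX, of i "Suc i"] unfolding a_def d by simp
      qed
      have "ln (\<theta> (a 0) v) \<le> ln (B + 1)"
        using \<theta>_le[OF aX v] B_nonneg by (subst ln_le_cancel_iff) auto
      moreover have "ln (exp (- ht (a 0))) \<le> ln (\<theta> (a 0) (a (D n)))"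
        using \<theta>_ge(1) by (subst ln_le_cancel_iff) auto
      then have "- c \<le> ln (\<theta> (a 0) (a (D n)))" using c[OF z, of n] unfolding a_def by simp
      moreover have "\<theta> (a (D n)) v \<le> 3 * e"
      proof -
        have "\<rho> (\<pi> (a (D n))) x \<le> \<rho> (\<pi> (a (D n))) (z n) + \<rho> (z n) x"
          using aX base_in z x by (intro Z.triangle) auto
        moreover have "exp (- min (ht (a (D n))) (ht v)) \<le> e"
          using n(3) unfolding a_def e_def by (auto simp: min_def)
        ultimately show ?thesis using n unfolding \<theta>_def a_def x_def by linarith
      qed
      then have "ln (\<theta> (a (D n)) v) \<le> ln (3 * e)" using e by (subst ln_le_cancel_iff) auto
      then have "ln (\<theta> (a (D n)) v) \<le> ln 3 - ht v" unfolding e_def by (simp add: ln_mult)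
      ultimately show "Gromov_product d v (a 0) (a (D n)) \<le> c + ln (B + 1) + ln 3"
        unfolding Gromov_product_eq by linarith
    qed
    then show ?thesis using pX unfolding a_def by (meson max.coboundedI1)
  qed
  then show "quasi_isometry X d X d f"
    unfolding quasi_isometry_def using f by (intro conjI exI[of _ "max H 0"]) auto
qed

text \<open>The points \<open>(y, D + s)\<close> with \<open>y \<in> F\<close> are too many for their images to be distinguished by
  the coarse data \<open>\<kappa>\<close>.\<close>

lemma feature_image:
  fixes D n M :: nat and \<kappa> :: "'a \<Rightarrow> nat"
  assumes qi: "qi_embedding_with l C X d X d f"
    and z: "z \<in> Z" and F: "F \<subseteq> Z" "card F > n * M"
    and F_sep: "\<And>y y'. y \<in> F \<Longrightarrow> y' \<in> F \<Longrightarrow> y \<noteq> y' \<Longrightarrow> exp (- real D) \<le> \<rho> y y'"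
    and F_near: "\<And>y. y \<in> F \<Longrightarrow> \<rho> y z \<le> 3 * exp (- real D)"
    and \<kappa>: "\<And>y. y \<in> Z \<Longrightarrow> \<kappa> y < M"
    and \<kappa>_sep: "\<And>y y'. y \<in> Z \<Longrightarrow> y' \<in> Z \<Longrightarrow> \<kappa> y = \<kappa> y' \<Longrightarrow> \<rho> y y' > 4 * exp (- real (n * D)) \<Longrightarrow>
        \<rho> y y' \<le> 5 * exp (- real D) \<and> (y \<in> U \<or> y' \<in> U)"
  defines "R \<equiv> l * (l * (4 + C) / 2 + 2 * ln 4) + C" and "t \<equiv> ht (f (pt z (real D)))"
  assumes n: "real n \<ge> 2 * R + 2" and t: "t + R < real (n * D) - ln 4"
  shows "real D - R - ln 5 \<le> t" and "\<exists>y\<in>U \<inter> Z. \<rho> (\<pi> (f (pt z (real D)))) y \<le> exp (R - t)"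
proof -
  have l: "l \<ge> 1" and C: "C \<ge> 0" and fX: "\<And>p. p \<in> X \<Longrightarrow> f p \<in> X"
    and lower: "\<And>p q. p \<in> X \<Longrightarrow> q \<in> X \<Longrightarrow> 1 / l * d p q - C \<le> d (f p) (f q)"
    and upper: "\<And>p q. p \<in> X \<Longrightarrow> q \<in> X \<Longrightarrow> d (f p) (f q) \<le> l * d p q + C"
    using qi unfolding qi_embedding_with_def by auto
  \<comment> \<open>Raising the points by \<open>s\<close> makes \<open>d (q y) (q y')\<close> at
    least \<open>2 * s\<close>, and \<open>2 * s / l - C = 4\<close> is the separation wanted for
    the images. Accordingly \<open>R = l * (s + 2 * ln 4) + C\<close>.\<close>
  define s where "s = l * (4 + C) / 2"
  have s: "s \<ge> 0" unfolding s_def using l C by simp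
  define p where "p = pt z (real D)"
  define q where "q y = pt y (real D + s)" for y
  have pX: "p \<in> X" unfolding p_def using z by (simp add: pt_in)
  have qX: "q y \<in> X" if "y \<in> F" for y unfolding q_def using that F s by (auto intro!: pt_in)
  have fin: "finite F" using F(2) card.infinite by fastforce
  have near: "d (f (q y)) (f p) \<le> R" if y: "y \<in> F" for y
  proof -
    have "\<theta> (q y) p \<le> 4 * exp (- real D)"
      using F_near[OF y] y F z s unfolding \<theta>_def q_def p_def by (auto simp: base_pt ht_pt min_def)
    then have "d (q y) p \<le> ht (q y) + ht p + 2 * ln (4 * exp (- real D))" by (rule d_le)
    also have "\<dots> = s + 2 * ln 4"
      using y F z s unfolding q_def p_def by (auto simp: ht_pt ln_mult)
    finally have "l * d (q y) p \<le> l * (s + 2 * ln 4)" using l by (intro mult_left_mono) auto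
    then show ?thesis using upper[OF qX[OF y] pX] unfolding R_def s_def by linarith
  qed
  have far: "d (f (q y)) (f (q y')) \<ge> 4" if y: "y \<in> F" "y' \<in> F" "y \<noteq> y'" for y y'
  proof -
    have "exp (- real D) \<le> \<theta> (q y) (q y')"
      using F_sep[OF y] subsetD[OF F(1) y(1)] subsetD[OF F(1) y(2)] s
      unfolding \<theta>_def q_def by (simp add: base_pt add_increasing2)
    then have "ln (exp (- real D)) \<le> ln (\<theta> (q y) (q y'))" by (subst ln_le_cancel_iff) auto
    then have "2 * s \<le> d (q y) (q y')"
      using subsetD[OF F(1) y(1)] subsetD[OF F(1) y(2)] s unfolding d_def q_def by (simp add: ht_pt)
    then have "1 / l * (2 * s) \<le> 1 / l * d (q y) (q y')" using l by (intro mult_left_mono) auto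
    moreover have "1 / l * (2 * s) = 4 + C" unfolding s_def using l by simp
    ultimately show ?thesis using lower[OF qX[OF y(1)] qX[OF y(2)]] by linarith
  qed
  have ht_near: "\<bar>ht (f (q y)) - t\<bar> \<le> R" if y: "y \<in> F" for y
    using near[OF y] abs_ht_le_d[of "f (q y)" "f p"] unfolding t_def p_def by linarith
  \<comment> \<open>Pigeonhole data: the height relative to \<open>t\<close>, to unit precision, and
    the class of the base point. The first takes at most \<open>2 * R + 2\<close> values, hence at
    most \<open>n\<close>; the second takes at most \<open>M\<close>.\<close>
  define g where "g y = (\<lfloor>ht (f (q y)) - t\<rfloor>, \<kappa> (\<pi> (f (q y))))" for y
  have "g ` F \<subseteq> {\<lfloor>- R\<rfloor>..\<lfloor>R\<rfloor>} \<times> {..<M}"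
  proof
    fix k assume "k \<in> g ` F"
    then obtain y where y: "y \<in> F" "k = g y" by blast
    have "- R \<le> ht (f (q y)) - t" "ht (f (q y)) - t \<le> R" using ht_near[OF y(1)] by linarith+
    then have "\<lfloor>- R\<rfloor> \<le> \<lfloor>ht (f (q y)) - t\<rfloor>" "\<lfloor>ht (f (q y)) - t\<rfloor> \<le> \<lfloor>R\<rfloor>" by (simp_all only: floor_mono)
    then show "k \<in> {\<lfloor>- R\<rfloor>..\<lfloor>R\<rfloor>} \<times> {..<M}"
      unfolding y(2) g_def using \<kappa>[OF base_in[OF fX[OF qX[OF y(1)]]]] by auto
  qed
  then have "card (g ` F) \<le> card ({\<lfloor>- R\<rfloor>..\<lfloor>R\<rfloor>} \<times> {..<M})"
    by (intro card_mono) auto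
  also have "\<dots> = nat (\<lfloor>R\<rfloor> - \<lfloor>- R\<rfloor> + 1) * M" by (simp add: card_cartesian_product)
  also have "\<dots> \<le> n * M"
  proof (rule mult_right_mono)
    have "of_int (\<lfloor>R\<rfloor> - \<lfloor>- R\<rfloor> + 1) \<le> real n" using n by linarith
    then show "nat (\<lfloor>R\<rfloor> - \<lfloor>- R\<rfloor> + 1) \<le> n" by linarith
  qed simp
  finally have "\<not> inj_on g F" using F(2) by (intro pigeonhole) auto
  then obtain y y' where y: "y \<in> F" "y' \<in> F" "y \<noteq> y'" "g y = g y'" unfolding inj_on_def by blast
  define u u' where "u = f (q y)" and "u' = f (q y')"
  define m where "m = min (ht u) (ht u')"
  have u: "u \<in> X" "u' \<in> X" unfolding u_def u'_def using fX qX y by auto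
  have "\<lfloor>ht u - t\<rfloor> = \<lfloor>ht u' - t\<rfloor>" and \<kappa>_eq: "\<kappa> (\<pi> u) = \<kappa> (\<pi> u')"
    using y(4) unfolding g_def u_def u'_def by auto
  then have "\<bar>ht u - ht u'\<bar> \<le> 1" by linarith
  moreover have "4 \<le> ht u + ht u' + 2 * ln (\<theta> u u')"
    using far[OF y(1-3)] unfolding u_def u'_def d_def .
  \<comment> \<open>At distance 4 and with heights differing by at most 1,
    \<open>\<theta> u u'\<close> is at least twice its height term \<open>exp (- m)\<close>; the
    other half must come from \<open>\<rho>\<close>.\<close>
  ultimately have "3 / 2 - m \<le> ln (\<theta> u u')" unfolding m_def by linarith
  then have "exp (3 / 2 - m) \<le> \<theta> u u'" by (metis \<theta>_pos exp_ln exp_le_cancel_iff)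
  moreover have "exp (3 / 2 - m) \<ge> 2 * exp (- m)"
  proof -
    have "2 * exp (- m) \<le> exp (3 / 2) * exp (- m)"
      using exp_ge_add_one_self[of "3 / 2"] by (intro mult_right_mono) auto
    also have "\<dots> = exp (3 / 2 - m)" using exp_add[of "3 / 2" "- m"] by simp
    finally show ?thesis .
  qed
  ultimately have "exp (- m) \<le> \<rho> (\<pi> u) (\<pi> u')" unfolding \<theta>_def m_def by linarith
  moreover have "m \<le> t + R" unfolding m_def u_def using ht_near[OF y(1)] by linarith
  then have "exp (- (t + R)) \<le> exp (- m)" by simp
  ultimately have \<rho>_lower: "exp (- (t + R)) \<le> \<rho> (\<pi> u) (\<pi> u')" by linarith
  \<comment> \<open>The images lie low enough, by the assumption on \<open>t\<close>, for this
    separation to exceed the threshold of \<open>\<kappa>_sep\<close>.\<close>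
  have "4 * exp (- real (n * D)) = exp (ln 4 - real (n * D))"
    using exp_add[of "ln 4" "- real (n * D)"] by simp
  also have "\<dots> < exp (- (t + R))" using t by (simp only: exp_less_cancel_iff)
  finally have "4 * exp (- real (n * D)) < \<rho> (\<pi> u) (\<pi> u')" using \<rho>_lower by linarith
  from \<kappa>_sep[OF base_in[OF u(1)] base_in[OF u(2)] \<kappa>_eq this]
  have \<rho>_upper: "\<rho> (\<pi> u) (\<pi> u') \<le> 5 * exp (- real D)" and U: "\<pi> u \<in> U \<or> \<pi> u' \<in> U" by auto
  have "exp (- (t + R)) \<le> 5 * exp (- real D)" using \<rho>_lower \<rho>_upper by linarith
  also have "\<dots> = exp (ln 5 - real D)"
    using exp_add[of "ln 5" "- real D"] by simp
  finally show "real D - R - ln 5 \<le> t" by simp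
  have near_image: "\<rho> (\<pi> (f p)) (\<pi> (f (q y))) \<le> exp (R - t)" if y: "y \<in> F" for y
  proof -
    have "\<rho> (\<pi> (f p)) (\<pi> (f (q y))) \<le> \<theta> (f (q y)) (f p)"
      unfolding \<theta>_commute[of "f (q y)"] unfolding \<theta>_def by simp
    also have "\<dots> \<le> exp ((R - ht (f (q y)) - ht (f p)) / 2)" by (rule \<theta>_le_exp[OF near[OF y]])
    also have "\<dots> \<le> exp (R - t)"
      using ht_near[OF y] unfolding t_def p_def by (simp add: field_simps abs_le_iff)
    finally show ?thesis .
  qed
  from U show "\<exists>y\<in>U \<inter> Z. \<rho> (\<pi> (f (pt z (real D)))) y \<le> exp (R - t)"
  proof
    assume "\<pi> u \<in> U"
    then show ?thesis using near_image[OF y(1)] base_in[OF u(1)] unfolding u_def p_def by blast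
  next
    assume "\<pi> u' \<in> U"
    then show ?thesis using near_image[OF y(2)] base_in[OF u(2)] unfolding u'_def p_def by blast
  qed
qed

text \<open>Image heights grow at most like \<open>l * D n\<close>, which \<open>n * D n\<close>
  eventually beats, so \<open>feature_image\<close> applies for large \<open>n\<close>. It puts the
  image within \<open>exp (R - t)\<close> of the support of feature \<open>n\<close>, a ball of
  radius \<open>1 / (n + 1)\<close>; both sizes tend to 0.\<close>

lemma feature_points_almost_fixed:
  fixes D M :: "nat \<Rightarrow> nat" and \<kappa> :: "nat \<Rightarrow> 'a \<Rightarrow> nat"
  assumes z: "\<And>n. z n \<in> Z" and D: "\<And>n. D n > n"
    and F: "\<And>n. F n \<subseteq> Z" "\<And>n. card (F n) > n * M n"
    and F_sep: "\<And>n y y'. y \<in> F n \<Longrightarrow> y' \<in> F n \<Longrightarrow> y \<noteq> y' \<Longrightarrow> exp (- real (D n)) \<le> \<rho> y y'"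
    and F_near: "\<And>n y. y \<in> F n \<Longrightarrow> \<rho> y (z n) \<le> 3 * exp (- real (D n))"
    and \<kappa>: "\<And>n y. y \<in> Z \<Longrightarrow> \<kappa> n y < M n"
    and \<kappa>_sep: "\<And>n y y'. y \<in> Z \<Longrightarrow> y' \<in> Z \<Longrightarrow> \<kappa> n y = \<kappa> n y' \<Longrightarrow> \<rho> y y' > 4 * exp (- real (n * D n)) \<Longrightarrow>
        \<rho> y y' \<le> 5 * exp (- real (D n)) \<and>
        (dist y (z n) < 1 / real (Suc n) \<or> dist y' (z n) < 1 / real (Suc n))"
    and f: "qi_embedding X d X d f" and e: "e > 0"
  shows "\<forall>\<^sub>F n in sequentially.
    \<rho> (\<pi> (f (pt (z n) (D n)))) (z n) < e \<and> exp (- ht (f (pt (z n) (D n)))) < e"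
proof -
  obtain l C where qi: "qi_embedding_with l C X d X d f" using f unfolding qi_embedding_def by blast
  then have l: "l \<ge> 1" and C: "C \<ge> 0" and fX: "\<And>p. p \<in> X \<Longrightarrow> f p \<in> X"
    and upper: "\<And>p q. p \<in> X \<Longrightarrow> q \<in> X \<Longrightarrow> d (f p) (f q) \<le> l * d p q + C"
    unfolding qi_embedding_with_def by auto
  obtain c where c: "\<And>x. x \<in> Z \<Longrightarrow> ht (f (pt x 0)) \<le> c"
    using ht_image_level_0_bounded[OF qi] by blast
  define R where "R = l * (l * (4 + C) / 2 + 2 * ln 4) + C"
  have R: "R \<ge> 0" unfolding R_def using l C by (intro add_nonneg_nonneg mult_nonneg_nonneg) auto
  obtain \<delta> where \<delta>: "\<delta> > 0" "\<And>x y. x \<in> Z \<Longrightarrow> y \<in> Z \<Longrightarrow> dist x y < \<delta> \<Longrightarrow> \<rho> x y < e / 2"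
    using fine[of "e / 2"] e by auto
  have ht: "ht (f (pt (z n) (D n))) \<le> c + l * D n + C" for n
  proof -
    have "d (pt (z n) 0) (pt (z n) (D n)) = D n" using z by (simp add: d_pt_same)
    then have "d (f (pt (z n) 0)) (f (pt (z n) (D n))) \<le> l * D n + C"
      using upper[of "pt (z n) 0" "pt (z n) (D n)"] z by (simp add: pt_in)
    then show ?thesis
      using abs_ht_le_d[of "f (pt (z n) 0)" "f (pt (z n) (D n))"] c[OF z, of n] by linarith
  qed
  have lim: "filterlim (\<lambda>n. real n) at_top sequentially" by (rule filterlim_real_sequentially)
  \<comment> \<open>The four thresholds serve, in order, the pigeonhole count, the bound of
    \<open>t + R\<close> by \<open>n * D n - ln 4\<close>, the estimate
    \<open>exp (R - t) < e / 2\<close>, and the radius of the support.\<close>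
  have "\<forall>\<^sub>F n in sequentially. real n \<ge> 2 * R + 2"
    using lim unfolding filterlim_at_top by blast
  moreover have "\<forall>\<^sub>F n in sequentially. real n \<ge> l + \<bar>c\<bar> + C + R + ln 4 + 1"
    using lim unfolding filterlim_at_top by blast
  moreover have "\<forall>\<^sub>F n in sequentially. real n \<ge> 2 * R + ln 5 - ln (e / 2)"
    using lim unfolding filterlim_at_top by blast
  moreover have "\<forall>\<^sub>F n in sequentially. real n \<ge> 1 / \<delta>"
    using lim unfolding filterlim_at_top by blast
  ultimately show ?thesis
  proof eventually_elim
    case (elim n)
    define t where "t = ht (f (pt (z n) (D n)))"
    have Dn: "real (D n) \<ge> real n + 1" using D[of n] by linarith
    have "(l + (\<bar>c\<bar> + C + R + ln 4 + 1)) * real (D n) \<le> real n * real (D n)"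
      using elim(2) by (intro mult_right_mono) auto
    moreover have "(\<bar>c\<bar> + C + R + ln 4 + 1) * 1 \<le> (\<bar>c\<bar> + C + R + ln 4 + 1) * real (D n)"
      using Dn C R by (intro mult_left_mono add_nonneg_nonneg) auto
    ultimately have "l * real (D n) + (\<bar>c\<bar> + C + R + ln 4 + 1) \<le> real n * real (D n)"
      by (simp only: ring_distribs mult_1_right)
    then have tR: "t + R < real (n * D n) - ln 4"
      using ht[of n] unfolding t_def by simp
    let ?U = "{y. dist y (z n) < 1 / real (Suc n)}"
    note hyps = qi z[of n] F(1)[of n] F(2)[of n] F_sep[of _ n] F_near[of _ n] \<kappa>[of _ n] _
      elim(1)[unfolded R_def] tR[unfolded R_def t_def]
    have "real (D n) - R - ln 5 \<le> t"
      unfolding R_def t_def by (rule feature_image(1)[where U = ?U, OF hyps]) (use \<kappa>_sep[of _ _ n] in auto)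
    moreover have "\<exists>y\<in>?U \<inter> Z. \<rho> (\<pi> (f (pt (z n) (D n)))) y \<le> exp (R - t)"
      unfolding R_def t_def by (rule feature_image(2)[where U = ?U, OF hyps]) (use \<kappa>_sep[of _ _ n] in auto)
    then obtain y where y: "y \<in> Z" "dist y (z n) < 1 / real (Suc n)"
        "\<rho> (\<pi> (f (pt (z n) (D n)))) y \<le> exp (R - t)"
      by blast
    ultimately have "R - t < ln (e / 2)" using elim(3) Dn by linarith
    then have "exp (R - t) < exp (ln (e / 2))" by (simp only: exp_less_cancel_iff)
    then have Rt: "exp (R - t) < e / 2" using e by simp
    have "1 / real (Suc n) \<le> \<delta>" using elim(4) \<delta>(1) by (simp add: field_simps)
    then have "\<rho> y (z n) < e / 2" using y z by (intro \<delta>(2)) auto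
    moreover have "f (pt (z n) (D n)) \<in> X" using fX z by (simp add: pt_in)
    then have "\<rho> (\<pi> (f (pt (z n) (D n)))) (z n) \<le> \<rho> (\<pi> (f (pt (z n) (D n)))) y + \<rho> y (z n)"
      using base_in y z by (intro Z.triangle) auto
    moreover have "exp (- t) \<le> exp (R - t)" using R by simp
    ultimately show ?case using y(3) Rt e unfolding t_def by linarith
  qed
qed

end

section \<open>A rigid metric on a compact perfect space\<close>

text \<open>With factorials each height is the power \<open>n + 2\<close> of the preceding one, so
  the ratio of consecutive logarithms eventually exceeds every linear distortion.\<close>

definition feature_height :: "nat \<Rightarrow> real"
  where "feature_height n = exp (- fact (Suc n))"

lemma feature_height_pos [simp]: "feature_height n > 0"
  unfolding feature_height_def by simp

lemma feature_height_nonneg [simp]: "feature_height n \<ge> 0"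
  unfolding feature_height_def by simp

lemma feature_height_Suc: "feature_height (Suc n) = exp (- real ((n + 2) * fact (Suc n)))"
  unfolding feature_height_def by (simp add: algebra_simps)

lemma feature_height_Suc_le: "feature_height (Suc n) \<le> feature_height n / 2"
proof -
  have "1 \<le> (fact (Suc n) :: real)" by (rule fact_ge_1)
  moreover have "2 * fact (Suc n) \<le> real (Suc (Suc n)) * fact (Suc n)" by (intro mult_right_mono) auto
  ultimately have "fact (Suc n) + 1 \<le> (fact (Suc (Suc n)) :: real)"
    by (subst (2) fact_Suc) linarith
  then have "feature_height (Suc n) \<le> exp (- fact (Suc n) - 1)"
    unfolding feature_height_def by (simp del: fact_Suc)
  also have "\<dots> = feature_height n * exp (- 1)"
    unfolding feature_height_def using exp_add[of "- fact (Suc n)" "- 1 :: real"] by (simp del: fact_Suc)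
  also have "\<dots> \<le> feature_height n * (1 / 2)"
  proof (rule mult_left_mono)
    have "inverse (exp 1) \<le> inverse (2 :: real)"
      using exp_ge_add_one_self[of 1] by (intro le_imp_inverse_le) auto
    then show "exp (- 1 :: real) \<le> 1 / 2" by (simp add: exp_minus)
  qed simp
  finally show ?thesis by simp
qed

lemma feature_height_add_le: "feature_height (n + k) \<le> feature_height n * (1 / 2) ^ k"
proof (induction k)
  case (Suc k)
  then show ?case using feature_height_Suc_le[of "n + k"] by simp
qed simp

lemma summable_feature_height: "summable feature_height"
  by (rule summable_comparison_test'[where g = "\<lambda>k. feature_height 0 * (1 / 2) ^ k" and N = 0])
    (use feature_height_add_le[of 0] in \<open>auto simp: abs_of_pos intro!: summable_mult summable_geometric\<close>)

text \<open>The truncation localises the feature: points at distance at least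
  \<open>1 / (n + 1)\<close> from \<open>z n\<close> all have the same value.\<close>

definition tent :: "(nat \<Rightarrow> 'a::metric_space) \<Rightarrow> nat \<Rightarrow> 'a \<Rightarrow> real"
  where "tent z n x = min (1 / real (Suc n)) (dist x (z n))"

text \<open>Here \<open>k\<close> is a candidate for the slope of the feature of index \<open>n\<close>, \<open>S\<close> is the sum of the slopes
  of the previous features, and the fibres of \<open>\<kappa>\<close> are too small to be separated by those.\<close>

definition good_stage ::
  "(nat \<Rightarrow> 'a::metric_space) \<Rightarrow> 'a set \<Rightarrow> nat \<Rightarrow> real \<Rightarrow> real \<Rightarrow> 'a set \<Rightarrow> nat \<Rightarrow> ('a \<Rightarrow> nat) \<Rightarrow> bool"
  where "good_stage z Z n S k F M \<kappa> \<longleftrightarrow>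
    F \<subseteq> Z \<and> card F > n * M \<and> (\<forall>y\<in>Z. \<kappa> y < M) \<and>
    (\<forall>y\<in>Z. \<forall>y'\<in>Z. \<kappa> y = \<kappa> y' \<longrightarrow> (1 + S) * dist y y' \<le> exp (- real ((n + 1) * fact (Suc n)))) \<and>
    (\<forall>y\<in>F. (1 + S) * dist y (z n) \<le> feature_height n) \<and>
    (\<forall>y\<in>F. \<forall>y'\<in>F. y \<noteq> y' \<longrightarrow> feature_height n \<le> k * \<bar>tent z n y - tent z n y'\<bar>)"

locale feature_metric =
  fixes z :: "nat \<Rightarrow> 'a::metric_space" and K :: "nat \<Rightarrow> real"
  assumes K_nonneg: "\<And>n. K n \<ge> 0"
begin

text \<open>A capped pseudometric. The cap keeps the triangle inequality and makes the sum converge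
  however steep the slopes \<open>K n\<close> are.\<close>

definition feature :: "nat \<Rightarrow> 'a \<Rightarrow> 'a \<Rightarrow> real"
  where "feature n x y = min (feature_height n) (K n * \<bar>tent z n x - tent z n y\<bar>)"

definition \<rho> :: "'a \<Rightarrow> 'a \<Rightarrow> real"
  where "\<rho> x y = dist x y + (\<Sum>n. feature n x y)"

lemma feature_nonneg: "feature n x y \<ge> 0"
  unfolding feature_def using K_nonneg by (simp add: less_imp_le)

lemma feature_le: "feature n x y \<le> feature_height n"
  unfolding feature_def by simp

lemma feature_same: "feature n x x = 0"
  unfolding feature_def by simp

lemma feature_le_dist: "feature n x y \<le> K n * dist x y"
proof -
  have "\<bar>tent z n x - tent z n y\<bar> \<le> dist x y"
    using dist_triangle[of x "z n" y] dist_triangle[of y "z n" x]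
    unfolding tent_def by (auto simp: dist_commute min_def)
  then have "K n * \<bar>tent z n x - tent z n y\<bar> \<le> K n * dist x y"
    using K_nonneg by (intro mult_left_mono)
  then show ?thesis unfolding feature_def by linarith
qed

lemma feature_triangle: "feature n x w \<le> feature n x y + feature n y w"
proof -
  have "K n * \<bar>tent z n x - tent z n w\<bar> \<le> K n * (\<bar>tent z n x - tent z n y\<bar> + \<bar>tent z n y - tent z n w\<bar>)"
    using K_nonneg by (intro mult_left_mono) linarith+
  then have "K n * \<bar>tent z n x - tent z n w\<bar> \<le> K n * \<bar>tent z n x - tent z n y\<bar> + K n * \<bar>tent z n y - tent z n w\<bar>"
    by (simp only: ring_distribs)
  moreover have "K n * \<bar>tent z n x - tent z n y\<bar> \<ge> 0" "K n * \<bar>tent z n y - tent z n w\<bar> \<ge> 0"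
    using K_nonneg by auto
  ultimately show ?thesis
    unfolding feature_def using feature_height_pos[of n] by linarith
qed

lemma summable_feature: "summable (\<lambda>n. feature n x y)"
  by (rule summable_comparison_test'[OF summable_feature_height, where N = 0])
    (simp add: feature_nonneg feature_le)

lemma dist_le_\<rho>: "dist x y \<le> \<rho> x y"
  unfolding \<rho>_def by (simp add: suminf_nonneg summable_feature feature_nonneg)

lemma feature_le_\<rho>: "feature n x y \<le> \<rho> x y"
proof -
  have "sum (\<lambda>n. feature n x y) {n} \<le> (\<Sum>n. feature n x y)"
    by (intro sum_le_suminf summable_feature) (auto simp: feature_nonneg)
  then show ?thesis unfolding \<rho>_def by (simp add: add_increasing)
qed

text \<open>Isolates feature \<open>n\<close>: the earlier ones are Lipschitz with constants
  \<open>K m\<close>, and the later ones are dominated by a geometric series.\<close>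

lemma \<rho>_le_Suc: "\<rho> x y \<le> (1 + (\<Sum>m<n. K m)) * dist x y + feature n x y + 2 * feature_height (Suc n)"
proof -
  have "(\<Sum>k. feature (k + Suc n) x y) \<le> (\<Sum>k. feature_height (Suc n) * (1 / 2) ^ k)"
  proof (rule suminf_le)
    show "feature (k + Suc n) x y \<le> feature_height (Suc n) * (1 / 2) ^ k" for k
      using feature_le[of "Suc n + k" x y] feature_height_add_le[of "Suc n" k] by (simp add: add.commute)
  qed (intro summable_ignore_initial_segment summable_feature summable_mult summable_geometric, simp)
  also have "\<dots> = 2 * feature_height (Suc n)"
    by (subst suminf_mult) (auto simp: suminf_geometric)
  finally have tail: "(\<Sum>k. feature (k + Suc n) x y) \<le> 2 * feature_height (Suc n)" .
  have "(\<Sum>m<n. feature m x y) \<le> (\<Sum>m<n. K m * dist x y)"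
    by (intro sum_mono feature_le_dist)
  then show ?thesis
    using tail suminf_split_initial_segment[OF summable_feature, of x y "Suc n"]
    unfolding \<rho>_def by (simp add: sum_distrib_right ring_distribs)
qed

lemma \<rho>_le: "\<rho> x y \<le> (1 + (\<Sum>m<n. K m)) * dist x y + 2 * feature_height n"
  using \<rho>_le_Suc[of x y n] feature_le[of n x y] feature_height_Suc_le[of n] by linarith

lemma Metric_space_\<rho>: "Metric_space Z \<rho>"
proof
  fix x y :: 'a
  show "0 \<le> \<rho> x y" using dist_le_\<rho>[of x y] order_trans[OF zero_le_dist] by blast
  show "\<rho> x y = \<rho> y x" unfolding \<rho>_def feature_def by (simp add: dist_commute abs_minus_commute)
next
  fix x y :: 'a
  show "\<rho> x y = 0 \<longleftrightarrow> x = y"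
  proof
    assume "\<rho> x y = 0"
    then have "dist x y \<le> 0" using dist_le_\<rho>[of x y] by simp
    then show "x = y" by simp
  qed (simp add: \<rho>_def feature_same)
next
  fix x y w :: 'a
  have "(\<Sum>n. feature n x w) \<le> (\<Sum>n. feature n x y + feature n y w)"
    by (intro suminf_le feature_triangle summable_add summable_feature)
  also have "\<dots> = (\<Sum>n. feature n x y) + (\<Sum>n. feature n y w)"
    by (intro suminf_add[symmetric] summable_feature)
  finally show "\<rho> x w \<le> \<rho> x y + \<rho> y w"
    unfolding \<rho>_def using dist_triangle[of x w y] by linarith
qed

lemma \<rho>_fine:
  assumes e: "e > 0"
  shows "\<exists>\<delta>>0. \<forall>x y. dist x y < \<delta> \<longrightarrow> \<rho> x y < e"
proof -
  have "feature_height \<longlonglongrightarrow> 0" using summable_feature_height by (rule summable_LIMSEQ_zero)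
  then have "\<forall>\<^sub>F n in sequentially. feature_height n < e / 4"
    using e by (intro order_tendstoD(2)) auto
  then obtain n where n: "feature_height n < e / 4" unfolding eventually_sequentially by blast
  define S where "S = 1 + (\<Sum>m<n. K m)"
  have S: "S > 0" unfolding S_def using K_nonneg by (simp add: sum_nonneg add_pos_nonneg)
  have "\<rho> x y < e" if "dist x y < e / (2 * S)" for x y
  proof -
    have "S * dist x y < e / 2" using that S by (simp add: field_simps)
    then show ?thesis using \<rho>_le[of x y n] n unfolding S_def by linarith
  qed
  then show ?thesis using e S by (intro exI[of _ "e / (2 * S)"]) auto
qed

lemma \<rho>_bounded:
  assumes "bounded Z"
  shows "\<exists>B. \<forall>x\<in>Z. \<forall>y\<in>Z. \<rho> x y \<le> B"
proof -
  obtain r where "\<And>x y. x \<in> Z \<Longrightarrow> y \<in> Z \<Longrightarrow> dist x y \<le> r"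
    using assms bounded_two_points by metis
  then have "\<rho> x y \<le> r + 2 * feature_height 0" if "x \<in> Z" "y \<in> Z" for x y
    using \<rho>_le[of x y 0] that by fastforce
  then show ?thesis by blast
qed

text \<open>Translates the choices of one stage, made in terms of \<open>dist\<close>, into the
  hypotheses on \<open>\<rho>\<close> of the rigidity argument, with
  \<open>D = (n + 1)!\<close>.\<close>

lemma good_stage_\<rho>:
  assumes stage: "good_stage z Z n (\<Sum>m<n. K m) (K n) F M \<kappa>"
  shows "y \<in> F \<Longrightarrow> y' \<in> F \<Longrightarrow> y \<noteq> y' \<Longrightarrow> exp (- real (fact (Suc n))) \<le> \<rho> y y'"
    and "y \<in> F \<Longrightarrow> \<rho> y (z n) \<le> 3 * exp (- real (fact (Suc n)))"
    and "y \<in> Z \<Longrightarrow> y' \<in> Z \<Longrightarrow> \<kappa> y = \<kappa> y' \<Longrightarrow> \<rho> y y' > 4 * exp (- real (n * fact (Suc n))) \<Longrightarrow>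
      \<rho> y y' \<le> 5 * exp (- real (fact (Suc n))) \<and>
      (dist y (z n) < 1 / real (Suc n) \<or> dist y' (z n) < 1 / real (Suc n))"
proof -
  have h: "exp (- real (fact (Suc n))) = feature_height n"
    unfolding feature_height_def by (simp del: fact_Suc)
  define E E' where "E = exp (- real (n * fact (Suc n)))"
    and "E' = exp (- real ((n + 1) * fact (Suc n)))"
  define S where "S = (\<Sum>m<n. K m)"
  have stage_\<kappa>: "\<And>y y'. y \<in> Z \<Longrightarrow> y' \<in> Z \<Longrightarrow> \<kappa> y = \<kappa> y' \<Longrightarrow> (1 + S) * dist y y' \<le> E'"
    and stage_near: "\<And>y. y \<in> F \<Longrightarrow> (1 + S) * dist y (z n) \<le> feature_height n"
    using stage by (simp_all only: good_stage_def E'_def S_def)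
  have stage_sep: "\<And>y y'. y \<in> F \<Longrightarrow> y' \<in> F \<Longrightarrow> y \<noteq> y' \<Longrightarrow>
      feature_height n \<le> K n * \<bar>tent z n y - tent z n y'\<bar>"
    using stage unfolding good_stage_def by blast
  have \<rho>: "\<rho> x y \<le> (1 + S) * dist x y + feature n x y + 2 * feature_height (Suc n)" for x y
    unfolding S_def by (rule \<rho>_le_Suc)
  show "exp (- real (fact (Suc n))) \<le> \<rho> y y'" if "y \<in> F" "y' \<in> F" "y \<noteq> y'"
  proof -
    have "feature n y y' = feature_height n"
      unfolding feature_def using stage_sep[OF that] by (rule min_absorb1)
    then show ?thesis using feature_le_\<rho>[of n y y'] unfolding h by simp
  qed
  show "\<rho> y (z n) \<le> 3 * exp (- real (fact (Suc n)))" if "y \<in> F"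
    using \<rho>[of y "z n"] stage_near[OF that] feature_le[of n y "z n"] feature_height_Suc_le[of n]
    unfolding h by linarith
  show "\<rho> y y' \<le> 5 * exp (- real (fact (Suc n))) \<and>
      (dist y (z n) < 1 / real (Suc n) \<or> dist y' (z n) < 1 / real (Suc n))"
    if y: "y \<in> Z" "y' \<in> Z" "\<kappa> y = \<kappa> y'" and gt: "\<rho> y y' > 4 * exp (- real (n * fact (Suc n)))"
  proof -
    define N :: nat where "N = fact (Suc n)"
    have "N \<le> (n + 1) * N" "n * N \<le> (n + 1) * N" "n * N \<le> (n + 2) * N" by simp_all
    then have le: "E' \<le> feature_height n" "E' \<le> E" "feature_height (Suc n) \<le> E"
      unfolding feature_height_Suc E_def E'_def h[symmetric] N_def[symmetric]
      by (simp_all only: exp_le_cancel_iff neg_le_iff_le of_nat_le_iff)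
    have "E > 0" unfolding E_def by simp
    note bounds = \<rho>[of y y'] stage_\<kappa>[OF y] feature_le[of n y y'] feature_height_Suc_le[of n]
      feature_height_pos[of n] le gt[folded E_def] \<open>E > 0\<close>
    have "\<rho> y y' \<le> 5 * feature_height n" using bounds by linarith
    \<comment> \<open>Within a class the distance and the earlier features contribute at most
      \<open>E\<close>, the later features at most \<open>2 * E\<close>. A total above
      \<open>4 * E\<close> must involve feature \<open>n\<close>.\<close>
    moreover have "feature n y y' > 0" using bounds by linarith
    then have "tent z n y \<noteq> tent z n y'" unfolding feature_def by (cases "tent z n y = tent z n y'") simp_all
    then have "dist y (z n) < 1 / real (Suc n) \<or> dist y' (z n) < 1 / real (Suc n)"
      unfolding tent_def by linarith
    ultimately show ?thesis unfolding h by blast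
  qed
qed

end

section \<open>Recursive choice of the slopes\<close>

lemma compact_index_cover:
  fixes Z :: "'a::metric_space set"
  assumes "compact Z" "e > 0"
  shows "\<exists>M (\<kappa> :: 'a \<Rightarrow> nat). (\<forall>y\<in>Z. \<kappa> y < M) \<and> (\<forall>y\<in>Z. \<forall>y'\<in>Z. \<kappa> y = \<kappa> y' \<longrightarrow> dist y y' \<le> e)"
proof -
  obtain T where T: "finite T" "Z \<subseteq> (\<Union>c\<in>T. ball c (e / 2))"
    using assms half_gt_zero unfolding compact_eq_totally_bounded by metis
  obtain g :: "'a \<Rightarrow> nat" and M where g: "g ` T = {i. i < M}" "inj_on g T"
    using finite_imp_inj_to_nat_seg[OF T(1)] by metis
  define c where "c y = (SOME c. c \<in> T \<and> dist c y < e / 2)" for y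
  have c: "c y \<in> T \<and> dist (c y) y < e / 2" if "y \<in> Z" for y
  proof -
    obtain c0 where "c0 \<in> T" "dist c0 y < e / 2" using T(2) \<open>y \<in> Z\<close> by fastforce
    then show ?thesis unfolding c_def by (intro someI_ex[of "\<lambda>c. c \<in> T \<and> dist c y < e / 2"]) blast
  qed
  have "dist y y' \<le> e" if y: "y \<in> Z" "y' \<in> Z" and eq: "g (c y) = g (c y')" for y y'
  proof -
    have "c y = c y'" using eq g(2) c y by (meson inj_onD)
    then show ?thesis using c[OF y(1)] c[OF y(2)] dist_triangle3[of y y' "c y"] by simp
  qed
  moreover have "g (c y) < M" if "y \<in> Z" for y
    using c[OF that] g(1) by blast
  ultimately show ?thesis by (intro exI[of _ M] exI[of _ "g \<circ> c"]) auto
qed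

text \<open>A feature sees a point only through its distance to \<open>z n\<close>, so the planted
  points must have pairwise distinct distances, not merely be distinct. The positive distances to a
  limit point have no least element.\<close>

lemma islimpt_infinite_dist:
  assumes lim: "x islimpt Z" and r: "r > 0"
  shows "infinite ((\<lambda>y. dist y x) ` {y \<in> Z. dist y x < r})"
proof
  let ?A = "(\<lambda>y. dist y x) ` {y \<in> Z. dist y x < r}"
  assume fin: "finite ?A"
  define e where "e = Min (insert r (?A - {0}))"
  have fin': "finite (insert r (?A - {0}))" using fin by simp
  have e: "e > 0" unfolding e_def using fin' r by (subst Min_gr_iff) (auto simp: order_less_le)
  obtain y where y: "y \<in> Z" "y \<noteq> x" "dist y x < e" using lim e unfolding islimpt_approachable by blast
  have "e \<le> r" unfolding e_def using fin' by (intro Min_le) auto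
  then have "dist y x \<in> ?A - {0}" using y by auto
  then have "e \<le> dist y x" unfolding e_def using fin' by (intro Min_le) auto
  then show False using y by simp
qed

text \<open>The order of choice avoids circularity: the classes depend on \<open>S\<close> alone,
  their number \<open>M\<close> fixes how many points to plant, and only then is the slope
  \<open>k\<close> taken large enough to separate these points.\<close>

lemma good_stage_exists:
  fixes z :: "nat \<Rightarrow> 'a::metric_space"
  assumes Z: "compact Z" and lim: "z n islimpt Z" and S: "S \<ge> 0"
  shows "\<exists>k\<ge>0. \<exists>F M \<kappa>. good_stage z Z n S k F M \<kappa>"
proof -
  define E where "E = exp (- real ((n + 1) * fact (Suc n)))"
  have "E / (1 + S) > 0" unfolding E_def using S by simp
  from compact_index_cover[OF Z this] obtain M and \<kappa> :: "'a \<Rightarrow> nat"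
    where \<kappa>: "\<forall>y\<in>Z. \<kappa> y < M" "\<forall>y\<in>Z. \<forall>y'\<in>Z. \<kappa> y = \<kappa> y' \<longrightarrow> dist y y' \<le> E / (1 + S)"
    by (elim exE conjE)
  \<comment> \<open>The first bound makes \<open>tent\<close> equal to the distance on
    \<open>F\<close>; the second gives the nearness condition of the stage.\<close>
  define r where "r = min (1 / real (Suc n)) (feature_height n / (1 + S))"
  have r: "r > 0" unfolding r_def using S by simp
  obtain A where A: "A \<subseteq> (\<lambda>y. dist y (z n)) ` {y \<in> Z. dist y (z n) < r}" "finite A" "card A = Suc (n * M)"
    using infinite_arbitrarily_large[OF islimpt_infinite_dist[OF lim r], of "Suc (n * M)"] by blast
  obtain F where F: "F \<subseteq> {y \<in> Z. dist y (z n) < r}" "A = (\<lambda>y. dist y (z n)) ` F" "inj_on (\<lambda>y. dist y (z n)) F"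
    using A(1) unfolding subset_image_inj by blast
  have card: "card F = Suc (n * M)" using A(3) F(2,3) by (simp add: card_image)
  then have fin: "finite F" using card.infinite by fastforce
  have tent: "tent z n y = dist y (z n)" if "y \<in> F" for y
    using F(1) that unfolding tent_def r_def by auto
  \<comment> \<open>Diagonal pairs contribute \<open>feature_height n / 0 = 0\<close>; inserting 0
    below makes the maximum nonnegative.\<close>
  define G where "G = (\<lambda>(y, y'). feature_height n / \<bar>tent z n y - tent z n y'\<bar>) ` (F \<times> F)"
  define k where "k = Max (insert 0 G)"
  have finG: "finite (insert 0 G)" unfolding G_def using fin by simp
  have "k \<ge> 0" unfolding k_def using finG by (intro Max_ge) auto
  have sep: "feature_height n \<le> k * \<bar>tent z n y - tent z n y'\<bar>" if y: "y \<in> F" "y' \<in> F" "y \<noteq> y'" for y y'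
  proof -
    have "tent z n y \<noteq> tent z n y'" using inj_onD[OF F(3) _ y(1,2)] y(3) tent[OF y(1)] tent[OF y(2)] by metis
    then have pos: "\<bar>tent z n y - tent z n y'\<bar> > 0" by simp
    have "feature_height n / \<bar>tent z n y - tent z n y'\<bar> \<in> G" unfolding G_def using y by force
    then have "feature_height n / \<bar>tent z n y - tent z n y'\<bar> \<le> k"
      unfolding k_def using finG by (intro Max_ge) auto
    then show ?thesis using pos by (simp add: pos_divide_le_eq)
  qed
  have near: "(1 + S) * dist y (z n) \<le> feature_height n" if "y \<in> F" for y
  proof -
    have "dist y (z n) < feature_height n / (1 + S)" using F(1) that unfolding r_def by auto
    then show ?thesis using S by (simp add: field_simps)
  qed
  have fine: "(1 + S) * dist y y' \<le> E" if "y \<in> Z" "y' \<in> Z" "\<kappa> y = \<kappa> y'" for y y'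
  proof -
    have "dist y y' \<le> E / (1 + S)" using \<kappa>(2) that by blast
    then show ?thesis using S by (simp add: field_simps)
  qed
  have "F \<subseteq> Z" "card F > n * M" using F(1) card by auto
  then have "good_stage z Z n S k F M \<kappa>"
    unfolding good_stage_def E_def[symmetric] by (intro conjI ballI impI \<kappa>(1) sep near fine)
  then show ?thesis using \<open>k \<ge> 0\<close> by blast
qed

text \<open>A stage depends on its predecessors only through the sum of their slopes. The dependent
  choice therefore builds the partial sums, started at 0, and the slopes are their
  differences.\<close>

lemma good_stages_exist:
  fixes z :: "nat \<Rightarrow> 'a::metric_space"
  assumes Z: "compact Z" and lim: "\<And>n. z n islimpt Z"
  shows "\<exists>K F M \<kappa>. \<forall>n. K n \<ge> 0 \<and> good_stage z Z n (\<Sum>m<n. K m) (K n) (F n) (M n) (\<kappa> n)"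
proof -
  define P where "P n S S' \<longleftrightarrow> S' - S \<ge> 0 \<and> (\<exists>F M \<kappa>. good_stage z Z n S (S' - S) F M \<kappa>)" for n S S'
  have "\<exists>f. \<forall>n. (f n \<ge> 0 \<and> (n = 0 \<longrightarrow> f n = 0)) \<and> P n (f n) (f (Suc n))"
  proof (rule dependent_nat_choice)
    show "\<exists>S::real. S \<ge> 0 \<and> (0 = (0::nat) \<longrightarrow> S = 0)" by auto
    fix S :: real and n :: nat assume "S \<ge> 0 \<and> (n = 0 \<longrightarrow> S = 0)"
    then have S: "S \<ge> 0" by simp
    obtain k F M \<kappa> where k: "k \<ge> 0" "good_stage z Z n S k F M \<kappa>"
      using good_stage_exists[where z = z and n = n, OF Z lim S] by (elim exE conjE)
    then have "P n S (S + k)" unfolding P_def add_diff_cancel_left' by (intro conjI exI)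
    then show "\<exists>S'. (S' \<ge> 0 \<and> (Suc n = 0 \<longrightarrow> S' = 0)) \<and> P n S S'"
      using S k(1) by (intro exI[of _ "S + k"]) simp
  qed
  then obtain f :: "nat \<Rightarrow> real" where "\<forall>n. (f n \<ge> 0 \<and> (n = 0 \<longrightarrow> f n = 0)) \<and> P n (f n) (f (Suc n))" ..
  then have f: "f 0 = 0" "\<And>n. P n (f n) (f (Suc n))" by simp_all
  define K where "K n = f (Suc n) - f n" for n
  have sum: "(\<Sum>m<n. K m) = f n" for n
    unfolding K_def using f(1) by (simp add: sum_lessThan_telescope)
  have "\<forall>n. \<exists>F M \<kappa>. K n \<ge> 0 \<and> good_stage z Z n (\<Sum>m<n. K m) (K n) F M \<kappa>"
    unfolding sum using f(2) unfolding P_def K_def by simp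
  then show ?thesis unfolding choice_iff by (rule exI[of _ K])
qed

section \<open>The rigid cone over a compact perfect set\<close>

lemma dense_sequence:
  fixes Z :: "'a::{metric_space, second_countable_topology} set"
  assumes "Z \<noteq> {}"
  shows "\<exists>z :: nat \<Rightarrow> 'a. (\<forall>n. z n \<in> Z) \<and> (\<forall>x\<in>Z. \<forall>e>0. \<forall>m. \<exists>n\<ge>m. dist (z n) x < e)"
proof -
  obtain T where T: "countable T" "T \<subseteq> Z" "Z \<subseteq> closure T"
    using separable[of Z] by blast
  then have T0: "T \<noteq> {}" using assms by auto
  \<comment> \<open>The second component of the decoded index is a dummy: it makes each point of
    \<open>T\<close> recur at arbitrarily large indices.\<close>
  define z where "z n = from_nat_into T (fst (prod_decode n))" for n
  have "\<exists>n\<ge>m. dist (z n) x < e" if x: "x \<in> Z" and e: "e > 0" for x e m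
  proof -
    obtain y where y: "y \<in> T" "dist y x < e" using T(3) x e closure_approachable by blast
    then obtain i where "from_nat_into T i = y" using from_nat_into_surj[OF T(1)] by metis
    then have "z (prod_encode (i, m)) = y" unfolding z_def by simp
    then show ?thesis using y(2) le_prod_encode_2 by blast
  qed
  moreover have "z n \<in> Z" for n unfolding z_def using T(2) from_nat_into[OF T0] by blast
  ultimately show ?thesis by blast
qed

text \<open>Used to encode the cone over a plane set as a set of reals; it applies the equipotence
  of the plane with the line twice.\<close>

lemma inj_times_real: "\<exists>g :: (real \<times> real) \<times> real \<Rightarrow> real. inj g"
proof -
  have "infinite (UNIV :: real set)" by (rule infinite_UNIV_char_0)
  then have "\<exists>g. bij_betw g (UNIV \<times> UNIV :: (real \<times> real) set) (UNIV :: real set)"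
    by (intro iffD2[OF card_of_ordIso] card_of_Times_same_infinite)
  then obtain g :: "real \<times> real \<Rightarrow> real" where "bij_betw g (UNIV \<times> UNIV) UNIV" ..
  then have g: "inj g" by (simp add: bij_betw_def)
  have "inj (\<lambda>q. g (g (fst q), snd q))"
    by (rule injI) (auto simp: prod_eq_iff dest!: injD[OF g])
  then show ?thesis by (rule exI[of inj])
qed

text \<open>Perfectness supplies arbitrarily many points at distinct distances near each
  \<open>z n\<close>; compactness supplies the finitely many classes and the endpoints of rays. The
  map \<open>g\<close> transports the cone to the type \<open>'p\<close>.\<close>

theorem compact_perfect_boundary_cone:
  fixes Z :: "'a::{metric_space, second_countable_topology} set" and g :: "'a \<times> real \<Rightarrow> 'p"
  assumes Z: "compact Z" "Z \<noteq> {}" and perfect: "\<And>x. x \<in> Z \<Longrightarrow> x islimpt Z" and g: "inj g"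
  shows "\<exists>\<rho> B X pt \<pi> ht. boundary_cone Z \<rho> B (X :: 'p set) pt \<pi> ht \<and> qi_co_Hopfian X (boundary_cone.d \<rho> \<pi> ht)"
proof -
  obtain z :: "nat \<Rightarrow> 'a" where z: "\<And>n. z n \<in> Z"
    and z_dense: "\<And>x e m. x \<in> Z \<Longrightarrow> e > 0 \<Longrightarrow> \<exists>n\<ge>m. dist (z n) x < e"
    using dense_sequence[OF Z(2)] by blast
  from good_stages_exist[of Z z, OF Z(1) perfect[OF z]] obtain K F M \<kappa>
    where K: "\<forall>n. K n \<ge> 0 \<and> good_stage z Z n (\<Sum>m<n. K m) (K n) (F n) (M n) (\<kappa> n)"
    by (elim exE)
  then have stage: "good_stage z Z n (\<Sum>m<n. K m) (K n) (F n) (M n) (\<kappa> n)" for n by simp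
  interpret feature_metric z K by standard (simp add: K)
  obtain B where B: "\<And>x y. x \<in> Z \<Longrightarrow> y \<in> Z \<Longrightarrow> \<rho> x y \<le> B"
    using \<rho>_bounded[OF compact_imp_bounded[OF Z(1)]] by blast
  define pt where "pt x s = g (x, s)" for x s
  define X where "X = (\<lambda>(x, s). pt x s) ` (Z \<times> {0..})"
  define \<pi> ht where "\<pi> p = fst (inv g p)" and "ht p = snd (inv g p)" for p
  interpret cone: boundary_cone Z \<rho> B X pt \<pi> ht
  proof (rule boundary_cone.intro)
    show "Metric_space Z \<rho>" by (rule Metric_space_\<rho>)
    show "\<exists>\<delta>>0. \<forall>x\<in>Z. \<forall>y\<in>Z. dist x y < \<delta> \<longrightarrow> \<rho> x y < e" if "e > 0" for e
      using \<rho>_fine[OF that] by blast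
  qed (use Z B X_def g in \<open>auto simp: pt_def \<pi>_def ht_def\<close>)
  have "qi_co_Hopfian X cone.d"
  proof (rule cone.qi_co_HopfianI[of z "\<lambda>n. fact (Suc n)"])
    show "z n \<in> Z" for n by (rule z)
    show "fact (Suc n) > (0::nat)" for n by simp
    show "\<exists>n\<ge>m. \<rho> (z n) x < e" if x: "x \<in> Z" and e: "e > 0" for x e m
    proof -
      obtain \<delta> where \<delta>: "\<delta> > 0" "\<And>x y. dist x y < \<delta> \<Longrightarrow> \<rho> x y < e" using \<rho>_fine[OF e] by blast
      obtain n where "n \<ge> m" "dist (z n) x < \<delta>" using z_dense[OF x \<delta>(1)] by blast
      then show ?thesis using \<delta>(2) by blast
    qed
    fix f e assume f: "qi_embedding X cone.d X cone.d f" and e: "(e::real) > 0"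
    have F: "F n \<subseteq> Z" "n * M n < card (F n)" and \<kappa>: "y \<in> Z \<Longrightarrow> \<kappa> n y < M n" for n y
      using stage[of n] unfolding good_stage_def by simp_all
    have D: "n < fact (Suc n)" for n using fact_ge_self[of "Suc n"] by linarith
    show "\<forall>\<^sub>F n in sequentially. \<rho> (\<pi> (f (pt (z n) (real (fact (Suc n)))))) (z n) < e \<and>
        exp (- ht (f (pt (z n) (real (fact (Suc n)))))) < e"
      by (rule cone.feature_points_almost_fixed[where z = z and D = "\<lambda>n. fact (Suc n)" and F = F and M = M and \<kappa> = \<kappa>,
            OF z D F good_stage_\<rho>(1)[OF stage] good_stage_\<rho>(2)[OF stage] \<kappa> good_stage_\<rho>(3)[OF stage] f e])
  qed
  with cone.boundary_cone_axioms show ?thesis by (intro exI conjI)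
qed

section \<open>The standard carpet\<close>

lemma carpet_corners_SucI:
  assumes "(x, y) \<in> carpet_corners n" "k \<le> 2" "l \<le> 2" "(k, l) \<noteq> (1, 1)"
  shows "(x + real k / 3 ^ Suc n, y + real l / 3 ^ Suc n) \<in> carpet_corners (Suc n)"
  unfolding carpet_corners.simps using assms by blast

lemma finite_carpet_corners: "finite (carpet_corners n)"
proof (induction n)
  case (Suc n)
  let ?f = "\<lambda>((x, y), (k, l)). (x + real k / 3 ^ Suc n, y + real l / 3 ^ Suc n)"
  have "carpet_corners (Suc n) \<subseteq> ?f ` (carpet_corners n \<times> ({..2} \<times> {..2}))"
  proof
    fix p assume "p \<in> carpet_corners (Suc n)"
    then obtain x y k l where "p = ?f ((x, y), (k, l))" "(x, y) \<in> carpet_corners n" "k \<le> 2" "l \<le> 2"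
      unfolding carpet_corners.simps by auto
    then show "p \<in> ?f ` (carpet_corners n \<times> ({..2} \<times> {..2}))"
      by (intro image_eqI[where x = "((x, y), (k, l))"]) auto
  qed
  moreover have "finite (?f ` (carpet_corners n \<times> ({..2} \<times> {..2})))" using Suc by blast
  ultimately show ?case by (rule finite_subset)
qed simp

definition carpet_level :: "nat \<Rightarrow> (real \<times> real) set"
  where "carpet_level n = (\<Union>(x, y)\<in>carpet_corners n. {x..x + 1 / 3 ^ n} \<times> {y..y + 1 / 3 ^ n})"

lemma standard_carpet_eq: "standard_carpet = (\<Inter>n. carpet_level n)"
  unfolding standard_carpet_def carpet_level_def ..

lemma compact_standard_carpet: "compact standard_carpet"
proof -
  have "compact (carpet_level n)" for n
    unfolding carpet_level_def
    by (intro compact_UN finite_carpet_corners) (auto intro!: compact_Times)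
  then show ?thesis unfolding standard_carpet_eq by (intro compact_Inter) auto
qed

lemma carpet_level_Suc_subset: "carpet_level (Suc n) \<subseteq> carpet_level n"
proof
  fix p assume "p \<in> carpet_level (Suc n)"
  then obtain x y k l where xy: "(x, y) \<in> carpet_corners n" and kl: "k \<le> 2" "l \<le> 2"
    and p: "fst p \<in> {x + real k / 3 ^ Suc n..x + real k / 3 ^ Suc n + 1 / 3 ^ Suc n}"
      "snd p \<in> {y + real l / 3 ^ Suc n..y + real l / 3 ^ Suc n + 1 / 3 ^ Suc n}"
    unfolding carpet_level_def by auto
  have "real k / 3 ^ Suc n + 1 / 3 ^ Suc n \<le> 1 / 3 ^ n" "real l / 3 ^ Suc n + 1 / 3 ^ Suc n \<le> 1 / 3 ^ n"
    using kl by (simp_all add: field_simps)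
  moreover have "real k / 3 ^ Suc n \<ge> 0" "real l / 3 ^ Suc n \<ge> 0" by simp_all
  ultimately have "fst p \<in> {x..x + 1 / 3 ^ n}" "snd p \<in> {y..y + 1 / 3 ^ n}"
    using p unfolding atLeastAtMost_iff by linarith+
  then have "p \<in> {x..x + 1 / 3 ^ n} \<times> {y..y + 1 / 3 ^ n}" by (simp add: mem_Times_iff)
  then show "p \<in> carpet_level n" unfolding carpet_level_def using xy by blast
qed

text \<open>The lower left subsquare, \<open>k = l = 0\<close>, is never removed, so a corner of one
  stage is a corner of all later ones.\<close>

lemma carpet_corners_subset: "carpet_corners n \<subseteq> standard_carpet"
proof
  fix p assume p: "p \<in> carpet_corners n"
  have mono: "carpet_corners n \<subseteq> carpet_corners (Suc n)" for n
  proof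
    fix p assume "p \<in> carpet_corners n"
    then show "p \<in> carpet_corners (Suc n)"
      using carpet_corners_SucI[of "fst p" "snd p" n 0 0] by simp
  qed
  have "p \<in> carpet_level m" for m
  proof -
    have "p \<in> carpet_corners (max m n)"
      using lift_Suc_mono_le[of carpet_corners, OF mono, of n "max m n"] p by auto
    then have "p \<in> carpet_level (max m n)"
      unfolding carpet_level_def by (cases p) force
    then show ?thesis
      using lift_Suc_antimono_le[of carpet_level, OF carpet_level_Suc_subset, of m "max m n"] by auto
  qed
  then show "p \<in> standard_carpet" unfolding standard_carpet_eq by blast
qed

text \<open>The square of a late stage containing \<open>p\<close> holds two different corners, both
  in the carpet and close to \<open>p\<close>; at least one of them is not \<open>p\<close>.\<close>

lemma standard_carpet_perfect:
  assumes p: "p \<in> standard_carpet"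
  shows "p islimpt standard_carpet"
  unfolding islimpt_approachable
proof (intro allI impI)
  fix e :: real assume e: "e > 0"
  obtain n where n: "(1 / 3) ^ n < e / 2" using real_arch_pow_inv[of "e / 2" "1 / 3"] e by auto
  have "p \<in> carpet_level n" using p unfolding standard_carpet_eq by blast
  then obtain x y where xy: "(x, y) \<in> carpet_corners n"
    and p: "fst p \<in> {x..x + 1 / 3 ^ n}" "snd p \<in> {y..y + 1 / 3 ^ n}"
    unfolding carpet_level_def by auto
  have near: "dist (x', y) p < e" if "x' \<in> {x..x + 1 / 3 ^ n}" for x'
  proof -
    have "dist (x', y) p \<le> dist x' (fst p) + dist y (snd p)"
      unfolding dist_prod_def using sqrt_sum_squares_le_sum[of "dist x' (fst p)" "dist y (snd p)"] by simp
    also have "\<dots> \<le> (1 / 3) ^ n + (1 / 3) ^ n"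
      using that p unfolding dist_real_def by (intro add_mono) (auto simp: power_one_over abs_le_iff)
    finally show ?thesis using n by linarith
  qed
  \<comment> \<open>The middle subsquare of the bottom row is kept, and its corner lies on the
    bottom side of the square.\<close>
  have "(x + real 1 / 3 ^ Suc n, y + real 0 / 3 ^ Suc n) \<in> carpet_corners (Suc n)"
    using xy by (intro carpet_corners_SucI) auto
  then have "(x + real 1 / 3 ^ Suc n, y + real 0 / 3 ^ Suc n) \<in> standard_carpet"
    using carpet_corners_subset by blast
  then have "(x + 1 / 3 ^ Suc n, y) \<in> standard_carpet" by simp
  moreover have "(x, y) \<in> standard_carpet" using xy carpet_corners_subset by blast
  moreover have "dist (x, y) p < e" "dist (x + 1 / 3 ^ Suc n, y) p < e"
    by (intro near; simp add: field_simps)+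
  moreover have "(x, y) \<noteq> (x + 1 / 3 ^ Suc n, y)" by simp
  ultimately show "\<exists>q\<in>standard_carpet. q \<noteq> p \<and> dist q p < e" by metis
qed

lemma Sierpinski_carpet_standard: "Sierpinski_carpet (top_of_set standard_carpet)"
  unfolding Sierpinski_carpet_def
  using compact_standard_carpet
  by (simp add: compact_space_subtopology compactin_euclidean_iff homeomorphic_space_refl)

theorem theorem1p1:
  shows "\<exists>(X :: real set) d. Metric_space X d \<and>
    visual X d \<and> roughly_geodesic X d \<and> Gromov_hyperbolic X d \<and>
    qi_co_Hopfian X d \<and> boundary_is_Sierpinski_carpet X d"
proof -
  have "(0, 0) \<in> standard_carpet" using carpet_corners_subset[of 0] by simp
  then have nonempty: "standard_carpet \<noteq> {}" by blast
  obtain g :: "(real \<times> real) \<times> real \<Rightarrow> real" where g: "inj g" using inj_times_real by blast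
  obtain \<rho> B X pt \<pi> ht where cone: "boundary_cone standard_carpet \<rho> B (X :: real set) pt \<pi> ht"
    and co_Hopf: "qi_co_Hopfian X (boundary_cone.d \<rho> \<pi> ht)"
    using compact_perfect_boundary_cone[OF compact_standard_carpet nonempty standard_carpet_perfect g] by blast
  interpret boundary_cone standard_carpet \<rho> B X pt \<pi> ht by (rule cone)
  show ?thesis
    using Metric_space_cone visual_cone roughly_geodesic_cone Gromov_hyperbolic_cone co_Hopf
      boundary_is_Sierpinski_carpet_cone[OF Sierpinski_carpet_standard] by blast
qed

end
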